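(* Let $\lambda_0>0$, $\lambda_1>0$. Let $(\chi,\psi)$ be a strategy such that for every $k=1,2,\dots$ $$I_{\{g(Z_k^\chi)<1+R(Z_k^\chi)\}}\le\psi_k^\chi\le I_{\{g(Z_k^\chi)\le1+R(Z_k^\chi)\}}\qquad (a)$$ $P_{\theta_0}^\chi$-almost surely on $\{y^{(k)}:(1-\psi_1^\chi(y^{(1)}))\cdots(1-\psi_{k-1}^\chi(y^{(k-1)}))>0\}$, and $$\int f_{\theta_0}(y|\chi_{k+1})\,\rho\!\left(Z_k^\chi\frac{f_{\theta_1}(y|\chi_{k+1})}{f_{\theta_0}(y|\chi_{k+1})}\right)d\mu(y)=R(Z_k^\chi)\qquad (b)$$ $P_{\theta_0}^\chi$-almost surely on $\{y^{(k)}:(1-\psi_1^\chi(y^{(1)}))\cdots(1-\psi_k^\chi(y^{(k)}))>0\}$, and such that $$\int f_{\theta_0}(y|\chi_1)\,\rho\!\left(\frac{f_{\theta_1}(y|\chi_1)}{f_{\theta_0}(y|\chi_1)}\right)d\mu(y)=R(1).\qquad (c)$$ Let $\phi=(\phi_1,\phi_2,\dots)$ be defined by $\phi_n=I_{\{\lambda_0f_{\theta_0}^n\le\lambda_1f_{\theta_1}^n\}}$, $n=1,2,\dots$. Then for any sequential testing procedure $(\chi',\psi',\phi')$ such that $$\alpha(\chi',\psi',\phi')\le\alpha(\chi,\psi,\phi)\quad\text{and}\quad\beta(\chi',\psi',\phi')\le\beta(\chi,\psi,\phi)\qquad (1)$$ it holds that $$N(\chi',\psi')\ge N(\chi,\psi).\qquad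 (2)$$ The inequality in (2) is strict if at least one of the inequalities in (1) is strict. If there are equalities in all of the inequalities in (1) and (2), then $(\chi',\psi')$ also satisfies (a), (b) (for every $k=1,2,\dots$) and (c), with $\chi'$ in place of $\chi$ and $\psi'$ in place of $\psi$.
   Context: Model. Controls $x$ take values in a measurable space; responses $y$ take values in a measurable space with a $\sigma$-finite measure $\mu$. For $\theta\in\{\theta_0,\theta_1\}$, $f_\theta(y|x)$ (measurable in $(x,y)$) is the density with respect to $\mu$ of the response when control $x$ is applied. Given controls, observations are independent; with $x^{(n)}=(x_1,\dots,x_n)$, $y^{(n)}=(y_1,\dots,y_n)$ put $f_\theta^n=f_\theta^n(x^{(n)},y^{(n)})=\prod_{i=1}^n f_\theta(y_i|x_i)$, a density with respect to the product measure $\mu^n=\mu\otimes\dots\otimes\mu$. The hypothesis $H_0:\theta=\theta_0$ is tested against $H_1:\theta=\theta_1$. A sequential testing procedure is a triplet $(\chi,\psi,\phi)$: a control policy $\chi=(\chi_1,\chi_2,\dots)$ with $\chi_n=\chi_n(x^{(n-1)},y^{(n-1)})$ measurable with values in the control space ($\chi_1$ constant), the control at stage $n$ being $x_n=\chi_n(x^{(n-1)},y^{(n-1)})$; a stopping rule $\psi=(\psi_1,\psi_2,\dots)$ with $\psi_n=\psi_n(x^{(n)},y^{(n)})\in[0,1]$ measurable (conditional probability of stopping at stage $n$); and a decision rule $\phi=(\phi_1,\phi_2,\dots)$ with $\phi_n=\phi_n(x^{(n)},y^{(n)})\in[0,1]$ measurable (conditional probability of rejecting $H_0$ when stopping at stage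 $n$). A pair $(\chi,\psi)$ is called a strategy. For any function $F_n=F_n(x^{(n)},y^{(n)})$ let $F_n^\chi(y^{(n)})=F_n(x^{(n)},y^{(n)})$ with $x_i=\chi_i(x^{(i-1)},y^{(i-1)})$, $i=1,\dots,n$; in particular $f_\theta^{n,\chi}=(f_\theta^n)^\chi$. $P_\theta^\chi$ is the law of the observations under $\theta$ and $\chi$: $y^{(n)}$ has density $f_\theta^{n,\chi}$ with respect to $\mu^n$, and $E_\theta^\chi F_n=\int F_n^\chi f_\theta^{n,\chi}d\mu^n$. The stopping time $\tau_\psi$ has $P_\theta^\chi(\tau_\psi=n)=E_\theta^\chi(1-\psi_1)\cdots(1-\psi_{n-1})\psi_n$. Error probabilities: $$\alpha(\chi,\psi,\phi)=\sum_{n=1}^\infty E_{\theta_0}^\chi(1-\psi_1)\cdots(1-\psi_{n-1})\psi_n\phi_n,\quad \beta(\chi,\psi,\phi)=\sum_{n=1}^\infty E_{\theta_1}^\chi(1-\psi_1)\cdots(1-\psi_{n-1})\psi_n(1-\phi_n).$$ Average sample number: $N(\chi,\psi)=E_{\theta_0}^\chi\tau_\psi=\sum_{n\ge1}nP_{\theta_0}^\chi(\tau_\psi=n)$ if $P_{\theta_0}^\chi(\tau_\psi<\infty)=1$, and $N(\chi,\psi)=\infty$ otherwise. Likelihood ratio: $Z_n=Z_n(x^{(n)},y^{(n)})=\prod_{i=1}^n\frac{f_{\theta_1}(y_i|x_i)}{f_{\theta_0}(y_i|x_i)}$. For $z\ge0$ let $\rho_0(z)=g(z)=\min\{\lambda_0,\lambda_1z\}$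 and, for $k=1,2,\dots$, $$\rho_k(z)=\min\Big\{g(z),\,1+\min_x\int f_{\theta_0}(y|x)\,\rho_{k-1}\Big(z\frac{f_{\theta_1}(y|x)}{f_{\theta_0}(y|x)}\Big)d\mu(y)\Big\}.$$ The sequence $\rho_k(z)$ is non-increasing in $k$; $\rho(z)=\lim_{k\to\infty}\rho_k(z)$, and $$R(z)=\min_x\int f_{\theta_0}(y|x)\,\rho\Big(z\frac{f_{\theta_1}(y|x)}{f_{\theta_0}(y|x)}\Big)d\mu(y).$$ (Integrands with the factor $f_{\theta_0}(y|x)$ are taken to be $0$ where $f_{\theta_0}(y|x)=0$.) Standing assumption: the functions $\rho_k$ and $R$ are well defined (minima exist) and measurable. Likewise, with $l_n=\min\{\lambda_0f_{\theta_0}^n,\lambda_1f_{\theta_1}^n\}$, $V_N^N=l_N$, $V_{k-1}^N=\min\{l_{k-1},f_{\theta_0}^{k-1}+R_{k-1}^N\}$ for $k=N,\dots,2$, $R_{k-1}^N(x^{(k-1)},y^{(k-1)})=\min_{x_k}\int V_k^N(x^{(k)},y^{(k)})d\mu(y_k)$ and $R_0^N=\min_{x_1}\int V_1^N(x_1,y_1)\,d\mu(y_1)$, all $R_k^N$ are well defined and measurable and $R_0^N$ is well defined (all this is true, e.g., if the controls can take only finitely many values). $I_A$ denotes the indicator of $A$. *)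

theory Defs
  imports "HOL-Analysis.Analysis"
begin

text \<open>
  \<open>X\<close> is the measurable space of controls (only its space and sets are used) and \<open>\<mu>\<close> the
  reference measure on the responses.  The vectors $x^{(n)}$, $y^{(n)}$ are extensional functions
  on \<open>{1..n}\<close>, so stages are numbered from 1, and a function of $(x^{(n)}, y^{(n)})$ is a
  curried function of two such vectors.  Values of rules at stage \<open>0\<close> are never used.
  A density $f_\theta(y|x)$ is written \<open>f y x\<close>.
\<close>

type_synonym ('x, 'y, 'v) stagefun = "(nat \<Rightarrow> 'x) \<Rightarrow> (nat \<Rightarrow> 'y) \<Rightarrow> 'v"

definition hist :: "'x measure \<Rightarrow> 'y measure \<Rightarrow> nat \<Rightarrow> ((nat \<Rightarrow> 'x) \<times> (nat \<Rightarrow> 'y)) measure" where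
  "hist X \<mu> n = (\<Pi>\<^sub>M i\<in>{1..n}. X) \<Otimes>\<^sub>M (\<Pi>\<^sub>M i\<in>{1..n}. \<mu>)"

definition cond_density :: "'x measure \<Rightarrow> 'y measure \<Rightarrow> ('y \<Rightarrow> 'x \<Rightarrow> real) \<Rightarrow> bool" where
  "cond_density X \<mu> f \<longleftrightarrow>
     (\<lambda>(x, y). f y x) \<in> borel_measurable (X \<Otimes>\<^sub>M \<mu>) \<and>
     (\<forall>x\<in>space X. \<forall>y\<in>space \<mu>. 0 \<le> f y x) \<and>
     (\<forall>x\<in>space X. (\<integral>\<^sup>+ y. ennreal (f y x) \<partial>\<mu>) = 1)"

definition control_policy ::
  "'x measure \<Rightarrow> 'y measure \<Rightarrow> (nat \<Rightarrow> ('x, 'y, 'x) stagefun) \<Rightarrow> bool" where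
  "control_policy X \<mu> chi \<longleftrightarrow>
     (\<forall>n. (\<lambda>(x, y). chi (Suc n) x y) \<in> measurable (hist X \<mu> n) X)"

text \<open>The common definition of stopping rules and decision rules.\<close>

definition randomized_rule ::
  "'x measure \<Rightarrow> 'y measure \<Rightarrow> (nat \<Rightarrow> ('x, 'y, real) stagefun) \<Rightarrow> bool" where
  "randomized_rule X \<mu> psi \<longleftrightarrow>
     (\<forall>n\<ge>1. (\<lambda>(x, y). psi n x y) \<in> borel_measurable (hist X \<mu> n) \<and>
       (\<forall>(x, y)\<in>space (hist X \<mu> n). 0 \<le> psi n x y \<and> psi n x y \<le> 1))"

definition strategy where
  "strategy X \<mu> chi psi \<longleftrightarrow> control_policy X \<mu> chi \<and> randomized_rule X \<mu> psi"

definition testing_procedure where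
  "testing_procedure X \<mu> chi psi phi \<longleftrightarrow> strategy X \<mu> chi psi \<and> randomized_rule X \<mu> phi"

text \<open>\<open>controls chi n y\<close> is the vector $x^{(n)}$ with $x_i = \chi_i(x^{(i-1)}, y^{(i-1)})$, and
  \<open>along chi n F\<close> is $F^\chi$ for a function \<open>F\<close> of $(x^{(n)}, y^{(n)})$.  The restrictions make both
  of them meaningful when \<open>y\<close> has more than \<open>n\<close> components.\<close>

primrec controls :: "(nat \<Rightarrow> ('x, 'y, 'x) stagefun) \<Rightarrow> nat \<Rightarrow> (nat \<Rightarrow> 'y) \<Rightarrow> (nat \<Rightarrow> 'x)" where
  "controls chi 0 y = (\<lambda>_. undefined)"
| "controls chi (Suc n) y =
     (controls chi n y)(Suc n := chi (Suc n) (controls chi n y) (restrict y {1..n}))"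

definition along ::
  "(nat \<Rightarrow> ('x, 'y, 'x) stagefun) \<Rightarrow> nat \<Rightarrow> ('x, 'y, 'v) stagefun \<Rightarrow> (nat \<Rightarrow> 'y) \<Rightarrow> 'v" where
  "along chi n F y = F (controls chi n y) (restrict y {1..n})"

definition dens :: "('y \<Rightarrow> 'x \<Rightarrow> real) \<Rightarrow> nat \<Rightarrow> ('x, 'y, real) stagefun" where
  "dens f n x y = (\<Prod>i=1..n. f (y i) (x i))"

text \<open>Where $f_{\theta_0} = 0$ the totalized quotient in \<open>lik_ratio\<close> is a dummy
  value; there $f_{\theta_0}^n = 0$, so this is a $P_{\theta_0}^\chi$-null set.\<close>

definition lik_ratio ::
  "('y \<Rightarrow> 'x \<Rightarrow> real) \<Rightarrow> ('y \<Rightarrow> 'x \<Rightarrow> real) \<Rightarrow> nat \<Rightarrow> ('x, 'y, real) stagefun" where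
  "lik_ratio f0 f1 n x y = (\<Prod>i=1..n. f1 (y i) (x i) / f0 (y i) (x i))"

text \<open>The law of $y^{(n)}$ under the density \<open>f\<close> and the policy \<open>chi\<close>, and the expectation of a
  nonnegative function of $(x^{(n)}, y^{(n)})$.\<close>

definition obs_law ::
  "'y measure \<Rightarrow> ('y \<Rightarrow> 'x \<Rightarrow> real) \<Rightarrow> (nat \<Rightarrow> ('x, 'y, 'x) stagefun) \<Rightarrow> nat \<Rightarrow> (nat \<Rightarrow> 'y) measure"
where
  "obs_law \<mu> f chi n = density (\<Pi>\<^sub>M i\<in>{1..n}. \<mu>) (\<lambda>y. ennreal (along chi n (dens f n) y))"

definition expect ::
  "'y measure \<Rightarrow> ('y \<Rightarrow> 'x \<Rightarrow> real) \<Rightarrow> (nat \<Rightarrow> ('x, 'y, 'x) stagefun) \<Rightarrow> nat \<Rightarrow>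
   ('x, 'y, real) stagefun \<Rightarrow> ennreal" where
  "expect \<mu> f chi n F =
     (\<integral>\<^sup>+ y. ennreal (along chi n F y * along chi n (dens f n) y) \<partial>(\<Pi>\<^sub>M i\<in>{1..n}. \<mu>))"

text \<open>\<open>reach psi n\<close> is $(1-\psi_1)\cdots(1-\psi_{n-1})$, a function of $(x^{(m)}, y^{(m)})$ for every
  $m \ge n - 1$.\<close>

definition reach :: "(nat \<Rightarrow> ('x, 'y, real) stagefun) \<Rightarrow> nat \<Rightarrow> ('x, 'y, real) stagefun" where
  "reach psi n x y = (\<Prod>i=1..<n. 1 - psi i (restrict x {1..i}) (restrict y {1..i}))"

definition prob_stop where
  "prob_stop \<mu> f chi psi n = expect \<mu> f chi n (\<lambda>x y. reach psi n x y * psi n x y)"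

definition err_alpha where
  "err_alpha \<mu> f0 chi psi phi =
     (\<Sum>m. let n = Suc m in expect \<mu> f0 chi n (\<lambda>x y. reach psi n x y * psi n x y * phi n x y))"

definition err_beta where
  "err_beta \<mu> f1 chi psi phi =
     (\<Sum>m. let n = Suc m in expect \<mu> f1 chi n (\<lambda>x y. reach psi n x y * psi n x y * (1 - phi n x y)))"

definition avg_sample_number where
  "avg_sample_number \<mu> f0 chi psi =
     (if (\<Sum>m. prob_stop \<mu> f0 chi psi (Suc m)) = 1
      then (\<Sum>m. of_nat (Suc m) * prob_stop \<mu> f0 chi psi (Suc m))
      else \<infinity>)"

text \<open>The functions $g$, $\rho_k$, $\rho$ and $R$.  A minimum over the controls is written as
  \<open>INF\<close>; that it is attained is required in \<open>rho_R_well_defined\<close> below, where \<open>rho\<close> and \<open>Rfun\<close>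
  are only considered on \<open>{0..}\<close>.  The integrand of \<open>next_val\<close> is \<open>0\<close> where \<open>f0\<close> vanishes.\<close>

definition gfun :: "real \<Rightarrow> real \<Rightarrow> real \<Rightarrow> real" where
  "gfun lam0 lam1 z = min lam0 (lam1 * z)"

definition next_val ::
  "'y measure \<Rightarrow> ('y \<Rightarrow> 'x \<Rightarrow> real) \<Rightarrow> ('y \<Rightarrow> 'x \<Rightarrow> real) \<Rightarrow> (real \<Rightarrow> real) \<Rightarrow> real \<Rightarrow> 'x \<Rightarrow> real"
where
  "next_val \<mu> f0 f1 h z x = (\<integral>y. f0 y x * h (z * (f1 y x / f0 y x)) \<partial>\<mu>)"

primrec rho ::
  "'x measure \<Rightarrow> 'y measure \<Rightarrow> ('y \<Rightarrow> 'x \<Rightarrow> real) \<Rightarrow> ('y \<Rightarrow> 'x \<Rightarrow> real) \<Rightarrow> real \<Rightarrow> real \<Rightarrow>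
   nat \<Rightarrow> real \<Rightarrow> real" where
  "rho X \<mu> f0 f1 lam0 lam1 0 = gfun lam0 lam1"
| "rho X \<mu> f0 f1 lam0 lam1 (Suc k) =
     (\<lambda>z. min (gfun lam0 lam1 z)
       (1 + (INF x\<in>space X. next_val \<mu> f0 f1 (rho X \<mu> f0 f1 lam0 lam1 k) z x)))"

definition rho_lim where
  "rho_lim X \<mu> f0 f1 lam0 lam1 z = lim (\<lambda>k. rho X \<mu> f0 f1 lam0 lam1 k z)"

definition Rfun where
  "Rfun X \<mu> f0 f1 lam0 lam1 z =
     (INF x\<in>space X. next_val \<mu> f0 f1 (rho_lim X \<mu> f0 f1 lam0 lam1) z x)"

definition min_exists :: "'a set \<Rightarrow> ('a \<Rightarrow> real) \<Rightarrow> bool" where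
  "min_exists A h \<longleftrightarrow> (\<exists>a. is_arg_min h (\<lambda>x. x \<in> A) a)"

definition rho_R_well_defined where
  "rho_R_well_defined X \<mu> f0 f1 lam0 lam1 \<longleftrightarrow>
     (\<forall>k. \<forall>z\<ge>0. min_exists (space X) (next_val \<mu> f0 f1 (rho X \<mu> f0 f1 lam0 lam1 k) z)) \<and>
     (\<forall>k. rho X \<mu> f0 f1 lam0 lam1 k \<in> borel_measurable (restrict_space borel {0..})) \<and>
     (\<forall>z\<ge>0. min_exists (space X) (next_val \<mu> f0 f1 (rho_lim X \<mu> f0 f1 lam0 lam1) z)) \<and>
     Rfun X \<mu> f0 f1 lam0 lam1 \<in> borel_measurable (restrict_space borel {0..})"

text \<open>The truncated problem with horizon \<open>N\<close>: \<open>V_trunc \<dots> N k\<close> is $V_k^N$, and \<open>R_trunc \<dots> N k\<close> is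
  $R_k^N$.\<close>

definition lfun :: "('y \<Rightarrow> 'x \<Rightarrow> real) \<Rightarrow> ('y \<Rightarrow> 'x \<Rightarrow> real) \<Rightarrow> real \<Rightarrow> real \<Rightarrow> nat \<Rightarrow>
  ('x, 'y, real) stagefun" where
  "lfun f0 f1 lam0 lam1 n x y = min (lam0 * dens f0 n x y) (lam1 * dens f1 n x y)"

function V_trunc ::
  "'x measure \<Rightarrow> 'y measure \<Rightarrow> ('y \<Rightarrow> 'x \<Rightarrow> real) \<Rightarrow> ('y \<Rightarrow> 'x \<Rightarrow> real) \<Rightarrow> real \<Rightarrow> real \<Rightarrow>
   nat \<Rightarrow> nat \<Rightarrow> ('x, 'y, real) stagefun" where
  "V_trunc X \<mu> f0 f1 lam0 lam1 N k x y =
     (if k < N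
      then min (lfun f0 f1 lam0 lam1 k x y)
             (dens f0 k x y +
              (INF u\<in>space X. \<integral>v. V_trunc X \<mu> f0 f1 lam0 lam1 N (Suc k)
                                    (x(Suc k := u)) (y(Suc k := v)) \<partial>\<mu>))
      else lfun f0 f1 lam0 lam1 k x y)"
  by pat_completeness auto
termination
  by (relation "Wellfounded.measure (\<lambda>(X, \<mu>, f0, f1, lam0, lam1, N, k, x, y). N - k)") auto

declare V_trunc.simps [simp del]

definition V_next where
  "V_next X \<mu> f0 f1 lam0 lam1 N k x y u =
     (\<integral>v. V_trunc X \<mu> f0 f1 lam0 lam1 N (Suc k) (x(Suc k := u)) (y(Suc k := v)) \<partial>\<mu>)"

definition R_trunc where
  "R_trunc X \<mu> f0 f1 lam0 lam1 N k x y =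
     (INF u\<in>space X. V_next X \<mu> f0 f1 lam0 lam1 N k x y u)"

lemma V_trunc_recursion:
  "V_trunc X \<mu> f0 f1 lam0 lam1 N N x y = lfun f0 f1 lam0 lam1 N x y"
  "k < N \<Longrightarrow> V_trunc X \<mu> f0 f1 lam0 lam1 N k x y =
     min (lfun f0 f1 lam0 lam1 k x y) (dens f0 k x y + R_trunc X \<mu> f0 f1 lam0 lam1 N k x y)"
  by (subst V_trunc.simps; simp add: R_trunc_def V_next_def)+

text \<open>For \<open>k = 0\<close> the space of \<open>hist X \<mu> 0\<close> is a single point, so that the first conjunct says that
  the minimum defining $R_0^N$ exists, and the second one is void.\<close>

definition trunc_well_defined where
  "trunc_well_defined X \<mu> f0 f1 lam0 lam1 \<longleftrightarrow>
     (\<forall>N\<ge>1. \<forall>k<N.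
        (\<forall>(x, y)\<in>space (hist X \<mu> k).
           min_exists (space X) (V_next X \<mu> f0 f1 lam0 lam1 N k x y)) \<and>
        (\<lambda>(x, y). R_trunc X \<mu> f0 f1 lam0 lam1 N k x y) \<in> borel_measurable (hist X \<mu> k))"

definition stop_cond where
  "stop_cond X \<mu> f0 f1 lam0 lam1 chi psi k \<longleftrightarrow>
     (AE y in obs_law \<mu> f0 chi k. along chi k (reach psi k) y > 0 \<longrightarrow>
        (let z = along chi k (lik_ratio f0 f1 k) y in
           of_bool (gfun lam0 lam1 z < 1 + Rfun X \<mu> f0 f1 lam0 lam1 z) \<le> along chi k (psi k) y \<and>
           along chi k (psi k) y \<le> of_bool (gfun lam0 lam1 z \<le> 1 + Rfun X \<mu> f0 f1 lam0 lam1 z)))"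

definition control_cond where
  "control_cond X \<mu> f0 f1 lam0 lam1 chi psi k \<longleftrightarrow>
     (AE y in obs_law \<mu> f0 chi k. along chi k (reach psi (Suc k)) y > 0 \<longrightarrow>
        (let z = along chi k (lik_ratio f0 f1 k) y in
           next_val \<mu> f0 f1 (rho_lim X \<mu> f0 f1 lam0 lam1) z (along chi k (chi (Suc k)) y)
             = Rfun X \<mu> f0 f1 lam0 lam1 z))"

text \<open>The first control $\chi_1$ is the value of \<open>chi 1\<close> at the empty history.\<close>

definition init_cond where
  "init_cond X \<mu> f0 f1 lam0 lam1 chi \<longleftrightarrow>
     next_val \<mu> f0 f1 (rho_lim X \<mu> f0 f1 lam0 lam1) 1 (chi 1 (\<lambda>_. undefined) (\<lambda>_. undefined))
       = Rfun X \<mu> f0 f1 lam0 lam1 1"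

end

theory Submission
  imports Defs
begin

text \<open>
  The error constraints are traded for Lagrange multipliers: a procedure is judged by the weighted
  cost \<open>N + \<lambda>\<^sub>0 \<alpha> + \<lambda>\<^sub>1 \<beta>\<close>.  A procedure whose weighted cost is finite and minimal cannot be
  beaten in \<open>N\<close> by one with smaller error probabilities, and any surplus in the weighted cost of a
  competitor carries over to the comparison of the sample numbers (\<open>constrained_from_weighted\<close>).

  For given stopping, the likelihood ratio test minimises the error part pointwise, and leaves the
  terminal loss \<open>g (Z\<^sub>n)\<close> per unit of the \<open>\<theta>\<^sub>0\<close>-probability.  What remains is an optimal stopping
  problem with controls, whose value is \<open>1 + R 1\<close>: one observation has to be paid for, and \<open>R\<close> is
  the cheapest expected value of \<open>\<rho>\<close> after it.

  Optimality is proved by verification.  The limit \<open>\<rho>\<close> solves \<open>\<rho> z = min (g z) (1 + R z)\<close>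
  (\<open>rho_lim_fixed_point\<close>; monotone limits commute with the infimum over controls, and dominated
  convergence handles the integral).  Follow any strategy
  and write down what it has paid so far plus what an optimal continuation would still cost.  In each
  stage this quantity can grow for two reasons only: the control does not attain the minimum in \<open>R\<close>,
  or the stopping rule does not choose the smaller of \<open>g\<close> and \<open>1 + R\<close>.  Measuring the growth by the
  nonnegative numbers \<open>control_loss\<close> and \<open>stop_loss\<close>, and summing over the stages, one gets an
  exact identity (\<open>cost_telescope\<close>): cost of stopping in the first \<open>k\<close> stages plus cost of continuing
  equals \<open>1 + R 1\<close> plus the losses.

  The losses of a strategy vanish exactly if it satisfies the conditions (a), (b) and (c), because a
  nonnegative function with integral \<open>0\<close> is \<open>0\<close> almost everywhere (\<open>control_cond_iff\<close>,
  \<open>init_cond_iff\<close>, \<open>stop_cond_iff\<close>).  Under these conditions the identity bounds \<open>(k + 1) P(\<tau> > k)\<close>, so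
  the procedure stops almost surely and its weighted cost is at most \<open>1 + R 1\<close>
  (\<open>weighted_cost_optimal\<close>).  For a competitor with finite \<open>N\<close>, \<open>(k + 1) P(\<tau> > k)\<close> tends to \<open>0\<close>, hence so
  does the cost of continuing, and the weighted cost is at least \<open>1 + R 1\<close> plus all its losses
  (\<open>weighted_cost_ge\<close>).  Equality in the theorem therefore forces all losses of the competitor to be
  \<open>0\<close>, which is the last claim.
\<close>

section \<open>Integrals and extended nonnegative reals\<close>

lemma nn_integral_add_ennreal:
  fixes f f' h :: "'a \<Rightarrow> real"
  assumes "f \<in> borel_measurable M" "f' \<in> borel_measurable M"
    and "\<And>y. y \<in> space M \<Longrightarrow> 0 \<le> f y" "\<And>y. y \<in> space M \<Longrightarrow> 0 \<le> f' y"
    and "\<And>y. y \<in> space M \<Longrightarrow> h y = f y + f' y"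
  shows "(\<integral>\<^sup>+ y. ennreal (h y) \<partial>M) = (\<integral>\<^sup>+ y. ennreal (f y) \<partial>M) + (\<integral>\<^sup>+ y. ennreal (f' y) \<partial>M)"
proof -
  have "(\<integral>\<^sup>+ y. ennreal (h y) \<partial>M) = (\<integral>\<^sup>+ y. ennreal (f y) + ennreal (f' y) \<partial>M)"
    using assms by (intro nn_integral_cong) simp
  then show ?thesis
    using assms(1,2) by (simp add: nn_integral_add)
qed

lemma ennreal_le_diff:
  fixes x s N :: ennreal
  assumes "x + s \<le> N" "x \<noteq> top"
  shows "s \<le> N - x"
proof -
  have "x + s - x \<le> N - x"
    using assms(1) by (intro ennreal_minus_mono) auto
  then show ?thesis
    using assms(2) by simp
qed

lemma nn_integral_ennreal_0_iff:
  assumes "h \<in> borel_measurable M" "\<And>y. y \<in> space M \<Longrightarrow> 0 \<le> h y"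
  shows "(\<integral>\<^sup>+ y. ennreal (h y) \<partial>M) = 0 \<longleftrightarrow> (AE y in M. h y = 0)"
proof -
  have "(\<integral>\<^sup>+ y. ennreal (h y) \<partial>M) = 0 \<longleftrightarrow> (AE y in M. ennreal (h y) = 0)"
    using assms(1) by (intro nn_integral_0_iff_AE) auto
  also have "\<dots> \<longleftrightarrow> (AE y in M. h y = 0)"
    using assms(2) by (intro AE_cong) (auto simp: ennreal_eq_0_iff antisym)
  finally show ?thesis .
qed

text \<open>
  The Lagrangian step.  Because \<open>a'\<close> and \<open>b'\<close> enter the right-hand side with positive weights, lowering
  them has to be paid for by \<open>N'\<close>.  The number \<open>d\<close> is a lower bound for
  the amount by which the competitor exceeds the minimal weighted cost.
\<close>

lemma constrained_from_weighted:
  fixes N a b N' a' b' d :: ennreal and l0 l1 :: real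
  assumes l: "0 < l0" "0 < l1"
    and le: "N + ennreal l0 * a + ennreal l1 * b + d \<le> N' + ennreal l0 * a' + ennreal l1 * b'"
    and fin: "N + ennreal l0 * a + ennreal l1 * b < \<infinity>" "N' < \<infinity>"
    and a: "a' \<le> a" and b: "b' \<le> b"
  shows "N \<le> N'" "a' < a \<or> b' < b \<Longrightarrow> N < N'" "a' = a \<Longrightarrow> b' = b \<Longrightarrow> N' = N \<Longrightarrow> d = 0"
proof -
  have "N < top" "a < top" "b < top"
    using fin(1) l by (auto simp: ennreal_mult_less_top ennreal_add_less_top)
  moreover from this have "a' < top" "b' < top"
    using a b by (auto intro: le_less_trans)
  moreover from this have "d < top"
  proof -
    have "d \<le> N' + ennreal l0 * a' + ennreal l1 * b'"
      using le by (metis add.commute le_iff_add order_trans)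
    also have "\<dots> < top"
      using fin(2) \<open>a' < top\<close> \<open>b' < top\<close> by (auto simp: ennreal_mult_less_top)
    finally show ?thesis .
  qed
  ultimately obtain n n' x x' y y' e where r:
    "N = ennreal n" "N' = ennreal n'" "a = ennreal x" "a' = ennreal x'" "b = ennreal y"
    "b' = ennreal y'" "d = ennreal e"
    "0 \<le> n" "0 \<le> n'" "0 \<le> x" "0 \<le> x'" "0 \<le> y" "0 \<le> y'" "0 \<le> e"
    using fin(2) by (auto simp: less_top_ennreal)
  then have "n + l0 * x + l1 * y + e \<le> n' + l0 * x' + l1 * y'"
    using le l by (simp add: ennreal_mult[symmetric] ennreal_plus[symmetric] del: ennreal_plus)
  moreover have "l0 * x' \<le> l0 * x" "l1 * y' \<le> l1 * y"
    using a b l r by (auto simp: ennreal_le_iff)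
  moreover have "l0 * x' < l0 * x \<or> l1 * y' < l1 * y" if "a' < a \<or> b' < b"
    using that l r by (auto simp: ennreal_less_iff)
  ultimately show "N \<le> N'" "a' < a \<or> b' < b \<Longrightarrow> N < N'" "a' = a \<Longrightarrow> b' = b \<Longrightarrow> N' = N \<Longrightarrow> d = 0"
    using r by (auto simp: ennreal_less_iff ennreal_le_iff)
qed

text \<open>
  This turns the two-sided bound on the stopping probability into one equation: a mixture of \<open>a\<close>
  and \<open>b\<close> is as small as possible iff it puts no mass on the strictly larger one.
\<close>

lemma randomized_choice_optimal_iff:
  fixes a b s :: real
  assumes "0 \<le> s" "s \<le> 1"
  shows "s * a + (1 - s) * b = min a b \<longleftrightarrow> of_bool (a < b) \<le> s \<and> s \<le> of_bool (a \<le> b)"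
proof -
  have "s * a + (1 - s) * b - min a b = (if a \<le> b then (1 - s) * (b - a) else s * (a - b))"
    by (simp add: algebra_simps)
  then have "s * a + (1 - s) * b = min a b \<longleftrightarrow> (if a \<le> b then s = 1 \<or> a = b else s = 0)"
    by (auto split: if_splits)
  then show ?thesis using assms by auto
qed

section \<open>Histories generated by a control policy\<close>

text \<open>
  The control at stage \<open>i\<close> looks only at responses before stage \<open>i\<close>, so the last response of the
  vector does not influence the controls.
\<close>

lemma controls_cong:
  "(\<And>i. i \<in> {1..<n} \<Longrightarrow> y i = y' i) \<Longrightarrow> controls chi n y = controls chi n y'"
proof (induction n)
  case (Suc n)
  then have "controls chi n y = controls chi n y'" "restrict y {1..n} = restrict y' {1..n}"
    by (auto simp: restrict_def fun_eq_iff)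
  then show ?case by simp
qed simp

lemma along_upd: "along chi n F (y(Suc n := v)) = along chi n F y"
  unfolding along_def
  by (intro arg_cong2[where f = F] controls_cong) (auto simp: restrict_def fun_eq_iff)

lemma restrict_controls: "i \<le> n \<Longrightarrow> restrict (controls chi n y) {1..i} = controls chi i y"
proof (induction n arbitrary: i)
  case 0
  then show ?case by (auto simp: restrict_def)
next
  case (Suc n)
  have outside: "controls chi n y j = undefined" if "j \<notin> {1..n}" for j
    using Suc.IH[of n] that by (metis order_refl restrict_apply)
  show ?case
  proof (cases "i = Suc n")
    case True
    then show ?thesis using outside by (auto simp: restrict_def fun_eq_iff)
  next
    case False
    then have "restrict (controls chi (Suc n) y) {1..i} = restrict (controls chi n y) {1..i}"
      using Suc.prems by (intro restrict_ext) auto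
    also have "\<dots> = controls chi i y"
      using Suc False by (intro Suc.IH) simp
    finally show ?thesis .
  qed
qed

text \<open>
  The factor for the last response \<open>y (Suc n)\<close> separates from the rest; this is what makes it
  possible to integrate out the responses one at a time.
\<close>

lemma along_dens_Suc:
  "along chi (Suc n) (dens f (Suc n)) y
     = along chi n (dens f n) y * f (y (Suc n)) (along chi n (chi (Suc n)) y)"
proof -
  have "along chi (Suc n) (dens f (Suc n)) y
    = (\<Prod>i=1..n. f (y i) (controls chi (Suc n) y i)) * f (y (Suc n)) (controls chi (Suc n) y (Suc n))"
    by (simp add: along_def dens_def)
  also have "(\<Prod>i=1..n. f (y i) (controls chi (Suc n) y i)) = along chi n (dens f n) y"
    by (auto simp: along_def dens_def intro!: prod.cong)
  finally show ?thesis by (simp add: along_def)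
qed

lemma along_lik_ratio:
  "along chi n (lik_ratio f0 f1 n) y = along chi n (dens f1 n) y / along chi n (dens f0 n) y"
  by (simp add: along_def lik_ratio_def dens_def prod_dividef)

lemma dens_measurable:
  assumes f: "(\<lambda>(x, y). f y x) \<in> borel_measurable (X \<Otimes>\<^sub>M \<mu>)"
  shows "(\<lambda>(x, y). dens f n x y) \<in> borel_measurable (hist X \<mu> n)"
proof -
  have "(\<lambda>p. (\<lambda>(x, y). f y x) (fst p i, snd p i)) \<in> borel_measurable (hist X \<mu> n)"
    if "i \<in> {1..n}" for i
    using f
  proof (rule measurable_compose[rotated])
    show "(\<lambda>p. (fst p i, snd p i)) \<in> measurable (hist X \<mu> n) (X \<Otimes>\<^sub>M \<mu>)"
      unfolding hist_def using that
      by (intro measurable_Pair measurable_compose[OF measurable_fst measurable_component_singleton]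
          measurable_compose[OF measurable_snd measurable_component_singleton]) auto
  qed
  then show ?thesis
    unfolding dens_def case_prod_beta by (intro borel_measurable_prod) simp
qed

section \<open>The optimal stopping equation\<close>

locale test_model =
  fixes X :: "'x measure" and \<mu> :: "'y measure"
    and f0 f1 :: "'y \<Rightarrow> 'x \<Rightarrow> real"
    and lam0 lam1 :: real
  assumes sigma_finite: "sigma_finite_measure \<mu>"
    and f0_density: "cond_density X \<mu> f0"
    and f1_density: "cond_density X \<mu> f1"
    and lam0_pos: "lam0 > 0"
    and lam1_pos: "lam1 > 0"
    and well_defined: "rho_R_well_defined X \<mu> f0 f1 lam0 lam1"
begin

text \<open>
  \<open>nv h z x\<close> is the \<open>\<theta>\<^sub>0\<close>-expectation of \<open>h\<close> at the likelihood ratio after one more response, if the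
  current ratio is \<open>z\<close> and the control \<open>x\<close> is applied.
\<close>

abbreviation "g \<equiv> gfun lam0 lam1"
abbreviation "\<rho>\<^sub>k \<equiv> rho X \<mu> f0 f1 lam0 lam1"
abbreviation "\<rho> \<equiv> rho_lim X \<mu> f0 f1 lam0 lam1"
abbreviation "R \<equiv> Rfun X \<mu> f0 f1 lam0 lam1"
abbreviation "nv \<equiv> next_val \<mu> f0 f1"

lemma f0_measurable[measurable]: "(\<lambda>(x, y). f0 y x) \<in> borel_measurable (X \<Otimes>\<^sub>M \<mu>)"
  and f1_measurable[measurable]: "(\<lambda>(x, y). f1 y x) \<in> borel_measurable (X \<Otimes>\<^sub>M \<mu>)"
  using f0_density f1_density by (auto simp: cond_density_def)

lemma f0_nonneg: "x \<in> space X \<Longrightarrow> y \<in> space \<mu> \<Longrightarrow> 0 \<le> f0 y x"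
  and f1_nonneg: "x \<in> space X \<Longrightarrow> y \<in> space \<mu> \<Longrightarrow> 0 \<le> f1 y x"
  using f0_density f1_density by (auto simp: cond_density_def)

lemma nn_integral_f0: "x \<in> space X \<Longrightarrow> (\<integral>\<^sup>+ y. ennreal (f0 y x) \<partial>\<mu>) = 1"
  using f0_density by (auto simp: cond_density_def)

lemma f0_section_measurable: "x \<in> space X \<Longrightarrow> (\<lambda>y. f0 y x) \<in> borel_measurable \<mu>"
  using measurable_Pair2[OF f0_measurable] by simp

lemma f0_integrable: "x \<in> space X \<Longrightarrow> integrable \<mu> (\<lambda>y. f0 y x)"
  and f0_integral: "x \<in> space X \<Longrightarrow> (\<integral>y. f0 y x \<partial>\<mu>) = 1"
proof -
  assume x: "x \<in> space X"
  show "integrable \<mu> (\<lambda>y. f0 y x)"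
    using x nn_integral_f0[OF x] f0_section_measurable[OF x] f0_nonneg[OF x]
    by (intro integrableI_nonneg) auto
  show "(\<integral>y. f0 y x \<partial>\<mu>) = 1"
    using x nn_integral_f0[OF x] f0_section_measurable[OF x] f0_nonneg[OF x]
    by (subst integral_eq_nn_integral) auto
qed

text \<open>
  The class of functions to which the integral operator \<open>nv\<close> is applied.  Likelihood ratios are
  nonnegative, so nothing is demanded on negative arguments; the bound \<open>lam0\<close> makes \<open>lam0 * f0\<close> a
  common integrable majorant.
\<close>

definition bounded_value :: "(real \<Rightarrow> real) \<Rightarrow> bool" where
  "bounded_value h \<longleftrightarrow> h \<in> borel_measurable (restrict_space borel {0..}) \<and>
     (\<forall>z\<ge>0. 0 \<le> h z \<and> h z \<le> lam0)"

lemma bounded_value_compose: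
  assumes h: "bounded_value h" and Z: "Z \<in> borel_measurable M"
    and pos: "\<And>w. w \<in> space M \<Longrightarrow> 0 \<le> Z w"
  shows "(\<lambda>w. h (Z w)) \<in> borel_measurable M"
proof -
  have "Z \<in> measurable M (restrict_space borel {0..})"
    using Z pos by (intro measurable_restrict_space2) auto
  then show ?thesis
    using h unfolding bounded_value_def by (auto intro: measurable_compose)
qed

text \<open>
  Stated for a ratio and a control that depend measurably on a history \<open>w\<close>, since the control of a
  strategy is itself a random variable.
\<close>

lemma next_val_integrand_measurable:
  assumes h: "bounded_value h" and Z[measurable]: "Z \<in> borel_measurable M"
    and pos: "\<And>w. w \<in> space M \<Longrightarrow> 0 \<le> Z w" and u[measurable]: "u \<in> measurable M X"
  shows "(\<lambda>(w, v). f0 v (u w) * h (Z w * (f1 v (u w) / f0 v (u w))))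
           \<in> borel_measurable (M \<Otimes>\<^sub>M \<mu>)"
proof -
  have [measurable]: "(\<lambda>p. f0 (snd p) (u (fst p))) \<in> borel_measurable (M \<Otimes>\<^sub>M \<mu>)"
    "(\<lambda>p. f1 (snd p) (u (fst p))) \<in> borel_measurable (M \<Otimes>\<^sub>M \<mu>)"
    using measurable_compose[of "\<lambda>p. (u (fst p), snd p)" "M \<Otimes>\<^sub>M \<mu>" "X \<Otimes>\<^sub>M \<mu>", OF _ f0_measurable]
      measurable_compose[of "\<lambda>p. (u (fst p), snd p)" "M \<Otimes>\<^sub>M \<mu>" "X \<Otimes>\<^sub>M \<mu>", OF _ f1_measurable]
    by simp_all
  have "(\<lambda>p. h (Z (fst p) * (f1 (snd p) (u (fst p)) / f0 (snd p) (u (fst p)))))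
          \<in> borel_measurable (M \<Otimes>\<^sub>M \<mu>)"
    using pos f0_nonneg f1_nonneg measurable_space[OF u]
    by (intro bounded_value_compose[OF h])
       (measurable, auto simp: space_pair_measure intro!: mult_nonneg_nonneg divide_nonneg_nonneg)
  then show ?thesis
    by (simp add: case_prod_beta)
qed

lemma next_val_integrand_bounds:
  assumes h: "bounded_value h" and z: "0 \<le> z" and x: "x \<in> space X" and v: "v \<in> space \<mu>"
  shows "0 \<le> f0 v x * h (z * (f1 v x / f0 v x))"
    and "f0 v x * h (z * (f1 v x / f0 v x)) \<le> lam0 * f0 v x"
proof -
  have "0 \<le> z * (f1 v x / f0 v x)"
    using z f0_nonneg[OF x v] f1_nonneg[OF x v] by (intro mult_nonneg_nonneg divide_nonneg_nonneg)
  then have "0 \<le> h (z * (f1 v x / f0 v x))" "h (z * (f1 v x / f0 v x)) \<le> lam0"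
    using h unfolding bounded_value_def by blast+
  then show "0 \<le> f0 v x * h (z * (f1 v x / f0 v x))"
    and "f0 v x * h (z * (f1 v x / f0 v x)) \<le> lam0 * f0 v x"
    using f0_nonneg[OF x v] by (auto simp: mult.commute[of lam0] intro: mult_left_mono)
qed

lemma next_val_integrable:
  assumes h: "bounded_value h" and z: "0 \<le> z" and x: "x \<in> space X"
  shows "integrable \<mu> (\<lambda>v. f0 v x * h (z * (f1 v x / f0 v x)))"
proof (rule Bochner_Integration.integrable_bound[where f = "\<lambda>v. lam0 * f0 v x"])
  show "integrable \<mu> (\<lambda>v. lam0 * f0 v x)"
    using f0_integrable[OF x] by simp
  have "(\<lambda>(w, v). f0 v (snd w) * h (fst w * (f1 v (snd w) / f0 v (snd w))))
           \<in> borel_measurable ((restrict_space borel {0..} \<Otimes>\<^sub>M X) \<Otimes>\<^sub>M \<mu>)"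
  proof (rule next_val_integrand_measurable[OF h])
    have "(\<lambda>w. w) \<in> borel_measurable (restrict_space (borel :: real measure) {0..})"
      by (rule measurable_restrict_space1) simp
    then show "fst \<in> borel_measurable (restrict_space (borel :: real measure) {0..} \<Otimes>\<^sub>M X)"
      by (rule measurable_compose[OF measurable_fst])
  qed (auto simp: space_pair_measure space_restrict_space)
  from measurable_Pair2[OF this, of "(z, x)"]
  show "(\<lambda>v. f0 v x * h (z * (f1 v x / f0 v x))) \<in> borel_measurable \<mu>"
    using z x by (simp add: space_pair_measure space_restrict_space)
  show "AE v in \<mu>. norm (f0 v x * h (z * (f1 v x / f0 v x))) \<le> norm (lam0 * f0 v x)"
    using next_val_integrand_bounds[OF h z x] by (intro AE_I2) fastforce
qed

lemma next_val_mono: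
  assumes "bounded_value h" "bounded_value h'" "\<And>z. 0 \<le> z \<Longrightarrow> h z \<le> h' z"
    and z: "0 \<le> z" and x: "x \<in> space X"
  shows "nv h z x \<le> nv h' z x"
  unfolding next_val_def
  using assms f0_nonneg[OF x] f1_nonneg[OF x]
  by (intro integral_mono next_val_integrable) (auto intro!: mult_left_mono)

lemma next_val_nonneg:
  assumes "bounded_value h" "0 \<le> z" "x \<in> space X"
  shows "0 \<le> nv h z x"
  unfolding next_val_def using assms
  by (intro Bochner_Integration.integral_nonneg next_val_integrand_bounds)

lemma next_val_le:
  assumes h: "bounded_value h" and z: "0 \<le> z" and x: "x \<in> space X"
  shows "nv h z x \<le> lam0"
proof -
  have "nv h z x \<le> (\<integral>v. lam0 * f0 v x \<partial>\<mu>)"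
    unfolding next_val_def
    using assms f0_integrable[OF x]
    by (intro integral_mono next_val_integrable next_val_integrand_bounds) auto
  also have "\<dots> = lam0" using f0_integral[OF x] by simp
  finally show ?thesis .
qed

lemma next_val_measurable:
  assumes "bounded_value h" "Z \<in> borel_measurable M"
    and "\<And>w. w \<in> space M \<Longrightarrow> 0 \<le> Z w" and "u \<in> measurable M X"
  shows "(\<lambda>w. nv h (Z w) (u w)) \<in> borel_measurable M"
proof -
  interpret sigma_finite_measure \<mu> by (rule sigma_finite)
  show ?thesis
    unfolding next_val_def
    using borel_measurable_lebesgue_integral[OF next_val_integrand_measurable[OF assms]] by simp
qed

lemma bdd_below_next_val: "bounded_value h \<Longrightarrow> 0 \<le> z \<Longrightarrow> bdd_below (nv h z ` space X)"
  by (intro bdd_belowI2[of _ 0] next_val_nonneg)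

lemma control_space_nonempty: "space X \<noteq> {}"
  using well_defined
  by (auto simp: rho_R_well_defined_def min_exists_def is_arg_min_def dest: spec[of _ "0::real"])

lemma g_bounds: "0 \<le> z \<Longrightarrow> 0 \<le> g z" "g z \<le> lam0"
  using lam0_pos lam1_pos by (auto simp: gfun_def)

lemma rhok_bounded: "bounded_value (\<rho>\<^sub>k k)"
proof (induction k)
  case 0
  then show ?case
    using well_defined g_bounds unfolding bounded_value_def rho_R_well_defined_def
    by (metis rho.simps(1))
next
  case (Suc k)
  have "0 \<le> (INF x\<in>space X. nv (\<rho>\<^sub>k k) z x)" if "0 \<le> z" for z
    using that control_space_nonempty Suc by (intro cINF_greatest next_val_nonneg)
  moreover have "\<rho>\<^sub>k (Suc k) \<in> borel_measurable (restrict_space borel {0..})"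
    using well_defined unfolding rho_R_well_defined_def by blast
  ultimately show ?case
    using g_bounds unfolding bounded_value_def by (auto simp: min.coboundedI1 add_nonneg_nonneg)
qed

text \<open>
  Allowing one more observation can only lower the value: the recursion is monotone and its
  first step is below \<open>g\<close>.
\<close>

lemma rhok_Suc_le: "0 \<le> z \<Longrightarrow> \<rho>\<^sub>k (Suc k) z \<le> \<rho>\<^sub>k k z"
proof (induction k arbitrary: z)
  case (Suc k)
  have "(INF x\<in>space X. nv (\<rho>\<^sub>k (Suc k)) z x) \<le> (INF x\<in>space X. nv (\<rho>\<^sub>k k) z x)"
    using Suc rhok_bounded control_space_nonempty
    by (intro cINF_mono bdd_below_next_val) (blast intro: next_val_mono)+
  then show ?case by (subst (1 2) rho.simps) linarith
qed simp

lemma rhok_tendsto: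
  assumes "0 \<le> z"
  shows "(\<lambda>k. \<rho>\<^sub>k k z) \<longlonglongrightarrow> \<rho> z" "\<rho> z \<le> \<rho>\<^sub>k k z" "0 \<le> \<rho> z"
proof -
  have dec: "decseq (\<lambda>k. \<rho>\<^sub>k k z)"
    using rhok_Suc_le assms by (intro decseq_SucI) auto
  moreover have "0 \<le> \<rho>\<^sub>k k z" for k
    using rhok_bounded assms by (auto simp: bounded_value_def)
  ultimately have "convergent (\<lambda>k. \<rho>\<^sub>k k z)"
    using decseq_convergent[of "\<lambda>k. \<rho>\<^sub>k k z" 0] by (metis convergent_def)
  then show lim: "(\<lambda>k. \<rho>\<^sub>k k z) \<longlonglongrightarrow> \<rho> z"
    by (simp add: rho_lim_def convergent_LIMSEQ_iff)
  show "\<rho> z \<le> \<rho>\<^sub>k k z"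
    using decseq_ge[OF dec lim] .
  show "0 \<le> \<rho> z"
    using LIMSEQ_le_const[OF lim, of 0] rhok_bounded assms by (auto simp: bounded_value_def)
qed

lemma rho_lim_bounded: "bounded_value \<rho>"
proof -
  have "\<rho> \<in> borel_measurable (restrict_space borel {0..})"
    by (rule borel_measurable_LIMSEQ_real[where u = \<rho>\<^sub>k])
       (use rhok_tendsto(1) rhok_bounded in \<open>auto simp: bounded_value_def space_restrict_space\<close>)
  then show ?thesis
    using rhok_tendsto(2)[of _ 0] rhok_tendsto(3) g_bounds(2)
    unfolding bounded_value_def by (metis order_trans rho.simps(1))
qed

lemma R_le: "0 \<le> z \<Longrightarrow> x \<in> space X \<Longrightarrow> R z \<le> nv \<rho> z x"
  unfolding Rfun_def by (intro cINF_lower bdd_below_next_val rho_lim_bounded)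

lemma R_attained: "0 \<le> z \<Longrightarrow> \<exists>x\<in>space X. R z = nv \<rho> z x"
proof -
  assume z: "0 \<le> z"
  then obtain x where x: "is_arg_min (nv \<rho> z) (\<lambda>x. x \<in> space X) x"
    using well_defined unfolding rho_R_well_defined_def min_exists_def by blast
  then have "nv \<rho> z x \<le> R z"
    unfolding Rfun_def using control_space_nonempty
    by (intro cINF_greatest) (auto simp: is_arg_min_def not_less)
  then show ?thesis
    using x R_le[OF z, of x] by (auto simp: is_arg_min_def intro!: bexI[of _ x] antisym)
qed

lemma R_bounded: "bounded_value R"
proof -
  have "R \<in> borel_measurable (restrict_space borel {0..})"
    using well_defined unfolding rho_R_well_defined_def by blast
  then show ?thesis
    using R_attained next_val_nonneg next_val_le rho_lim_bounded
    unfolding bounded_value_def[of R] by (metis)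
qed

lemma next_val_rhok_tendsto:
  assumes z: "0 \<le> z" and x: "x \<in> space X"
  shows "(\<lambda>k. nv (\<rho>\<^sub>k k) z x) \<longlonglongrightarrow> nv \<rho> z x"
  unfolding next_val_def
proof (rule integral_dominated_convergence[where w = "\<lambda>v. lam0 * f0 v x"])
  show "AE v in \<mu>. (\<lambda>k. f0 v x * \<rho>\<^sub>k k (z * (f1 v x / f0 v x)))
          \<longlonglongrightarrow> f0 v x * \<rho> (z * (f1 v x / f0 v x))"
    using z f0_nonneg[OF x] f1_nonneg[OF x] by (intro AE_I2 tendsto_mult_left rhok_tendsto) auto
  show "AE v in \<mu>. norm (f0 v x * \<rho>\<^sub>k k (z * (f1 v x / f0 v x))) \<le> lam0 * f0 v x" for k
    using next_val_integrand_bounds[OF rhok_bounded z x] by (intro AE_I2) fastforce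
qed (use f0_integrable[OF x] next_val_integrable[OF _ z x] rhok_bounded rho_lim_bounded in auto)

text \<open>
  Passing to the limit in the recursion needs the infimum over controls to commute with the limit.
  One inequality is monotonicity; for the other it suffices to follow a control that is optimal for
  the limit \<open>\<rho>\<close>, along which the integrals converge.
\<close>

lemma rho_lim_fixed_point:
  assumes z: "0 \<le> z"
  shows "\<rho> z = min (g z) (1 + R z)"
proof -
  obtain x where x: "x \<in> space X" "R z = nv \<rho> z x"
    using R_attained[OF z] by blast
  let ?I = "\<lambda>k. INF x\<in>space X. nv (\<rho>\<^sub>k k) z x"
  have "?I \<longlonglongrightarrow> R z"
  proof (rule tendsto_sandwich[OF _ _ tendsto_const])
    show "(\<lambda>k. nv (\<rho>\<^sub>k k) z x) \<longlonglongrightarrow> R z"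
      using next_val_rhok_tendsto[OF z x(1)] x(2) by simp
    show "\<forall>\<^sub>F k in sequentially. R z \<le> ?I k"
      unfolding Rfun_def
      using z rhok_bounded rho_lim_bounded control_space_nonempty
      by (intro always_eventually allI cINF_mono bdd_below_next_val)
         (blast intro: next_val_mono rhok_tendsto(2))+
    show "\<forall>\<^sub>F k in sequentially. ?I k \<le> nv (\<rho>\<^sub>k k) z x"
      using z rhok_bounded x by (intro always_eventually allI cINF_lower bdd_below_next_val)
  qed
  then have "(\<lambda>k. \<rho>\<^sub>k (Suc k) z) \<longlonglongrightarrow> min (g z) (1 + R z)"
    by (simp, intro tendsto_intros)
  then show ?thesis
    using LIMSEQ_Suc[OF rhok_tendsto(1)[OF z]] LIMSEQ_unique by blast
qed

text \<open>
  A Bayes test for the weights \<open>lam0\<close> and \<open>lam1\<close>.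
\<close>

definition lr_test :: "nat \<Rightarrow> ('x, 'y, real) stagefun" where
  "lr_test = (\<lambda>n x y. of_bool (lam0 * dens f0 n x y \<le> lam1 * dens f1 n x y))"

lemma lr_test_rule: "randomized_rule X \<mu> lr_test"
proof -
  have [measurable]: "(\<lambda>p. dens f0 n (fst p) (snd p)) \<in> borel_measurable (hist X \<mu> n)"
    "(\<lambda>p. dens f1 n (fst p) (snd p)) \<in> borel_measurable (hist X \<mu> n)" for n
    using dens_measurable[OF f0_measurable, of n] dens_measurable[OF f1_measurable, of n]
    by (simp_all add: case_prod_beta')
  have "(\<lambda>p. of_bool (lam0 * dens f0 n (fst p) (snd p) \<le> lam1 * dens f1 n (fst p) (snd p)) :: real)
      \<in> borel_measurable (hist X \<mu> n)" for n
    by measurable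
  then show ?thesis
    by (auto simp: randomized_rule_def lr_test_def case_prod_beta')
qed

end

section \<open>Processes generated by a strategy\<close>

locale test_strategy = test_model X \<mu> f0 f1 lam0 lam1
  for X :: "'x measure" and \<mu> :: "'y measure" and f0 f1 lam0 lam1 +
  fixes chi :: "nat \<Rightarrow> ('x, 'y, 'x) stagefun" and psi :: "nat \<Rightarrow> ('x, 'y, real) stagefun"
  assumes strategy: "strategy X \<mu> chi psi"
begin

text \<open>
  Everything observable is expressed as a function of the responses alone: the stopping probability
  \<open>q n\<close>, the densities \<open>L f n\<close> and likelihood ratio \<open>Z n\<close> after \<open>n\<close> responses, and the control \<open>u n\<close>
  applied next.  Expectations under \<open>\<theta>\<^sub>0\<close> are integrals over the product space \<open>Y n\<close> with the
  density \<open>L f0 n\<close>, so almost-sure statements are about points where \<open>L f0 n\<close> is positive.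
\<close>

abbreviation "Y n \<equiv> \<Pi>\<^sub>M i\<in>{1..n::nat}. \<mu>"
abbreviation "q n \<equiv> along chi n (psi n)"
abbreviation "L f n \<equiv> along chi n (dens f n)"
abbreviation "Z n \<equiv> along chi n (lik_ratio f0 f1 n)"
abbreviation "u n \<equiv> along chi n (chi (Suc n))"

definition live :: "nat \<Rightarrow> (nat \<Rightarrow> 'y) \<Rightarrow> real" where
  "live n y = (\<Prod>i=1..<n. 1 - q i y)"

lemma along_reach: "n \<le> Suc m \<Longrightarrow> along chi m (reach psi n) y = live n y"
  unfolding live_def along_def reach_def
  by (intro prod.cong refl, subst restrict_controls) (auto simp: Int_absorb1)

lemma live_Suc: "1 \<le> n \<Longrightarrow> live (Suc n) y = live n y * (1 - q n y)"
  by (simp add: live_def prod.atLeastLessThan_Suc)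

lemma live_1: "live (Suc 0) y = 1"
  by (simp add: live_def)

lemma q_upd: "q i (y(Suc n := v)) = q i y" if "i \<le> n"
  unfolding along_def using that
  by (intro arg_cong2[where f = "psi i"] controls_cong) (auto simp: restrict_def fun_eq_iff)

text \<open>
  Whether stage \<open>Suc n\<close> is reached has been decided by the first \<open>n\<close> responses.
\<close>

lemma live_upd: "live (Suc n) (y(Suc n := v)) = live (Suc n) y"
  unfolding live_def by (intro prod.cong) (auto simp: q_upd)

lemma controls_measurable: "n \<le> m \<Longrightarrow> controls chi n \<in> measurable (Y m) (\<Pi>\<^sub>M i\<in>{1..n}. X)"
proof (induction n)
  case 0
  then show ?case by (simp add: space_PiM_empty measurable_const)
next
  case (Suc n)
  have [measurable]: "controls chi n \<in> measurable (Y m) (\<Pi>\<^sub>M i\<in>{1..n}. X)"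
    "(\<lambda>y. restrict y {1..n}) \<in> measurable (Y m) (Y n)"
    using Suc by (auto intro!: measurable_restrict_subset)
  have [measurable]: "(\<lambda>(x, y). chi (Suc n) x y) \<in> measurable ((\<Pi>\<^sub>M i\<in>{1..n}. X) \<Otimes>\<^sub>M Y n) X"
    using strategy by (simp add: strategy_def control_policy_def hist_def)
  have "(\<lambda>y. (\<lambda>(x, y). chi (Suc n) x y) (controls chi n y, restrict y {1..n})) \<in> measurable (Y m) X"
    by measurable
  then have "(\<lambda>y. (controls chi n y)(Suc n := chi (Suc n) (controls chi n y) (restrict y {1..n})))
      \<in> measurable (Y m) (\<Pi>\<^sub>M i\<in>{1..Suc n}. X)"
    by (intro measurable_fun_upd[where J = "{1..n}"] \<open>controls chi n \<in> _\<close>)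
       (simp_all add: atLeastAtMostSuc_conv)
  then show ?case
    by (simp only: controls.simps(2)[abs_def])
qed

lemma hist_measurable:
  "n \<le> m \<Longrightarrow> (\<lambda>y. (controls chi n y, restrict y {1..n})) \<in> measurable (Y m) (hist X \<mu> n)"
  unfolding hist_def
  by (intro measurable_Pair controls_measurable measurable_restrict_subset) auto

lemma along_measurable:
  assumes "n \<le> m" "(\<lambda>(x, y). F x y) \<in> measurable (hist X \<mu> n) N"
  shows "along chi n F \<in> measurable (Y m) N"
  using measurable_compose[OF hist_measurable[OF assms(1)] assms(2)] by (simp add: along_def[abs_def])

lemma u_measurable[measurable]: "n \<le> m \<Longrightarrow> u n \<in> measurable (Y m) X"
  using strategy by (intro along_measurable) (auto simp: strategy_def control_policy_def)

lemma q_measurable: "1 \<le> n \<Longrightarrow> n \<le> m \<Longrightarrow> q n \<in> borel_measurable (Y m)"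
  using strategy by (intro along_measurable) (auto simp: strategy_def randomized_rule_def)

lemma along_rule_bounds:
  assumes "randomized_rule X \<mu> r" "1 \<le> n" "n \<le> m" "y \<in> space (Y m)"
  shows "0 \<le> along chi n (r n) y" "along chi n (r n) y \<le> 1"
  using assms measurable_space[OF hist_measurable[OF assms(3)] assms(4)]
  by (auto simp: randomized_rule_def along_def)

lemma q_bounds:
  assumes "1 \<le> n" "n \<le> m" "y \<in> space (Y m)"
  shows "0 \<le> q n y" "q n y \<le> 1"
  using along_rule_bounds[OF _ assms] strategy by (auto simp: strategy_def)

lemma u_space: "y \<in> space (Y n) \<Longrightarrow> u n y \<in> space X"
  using measurable_space[OF u_measurable[OF order_refl]] .

lemma L_measurable[measurable]: "L f0 n \<in> borel_measurable (Y n)" "L f1 n \<in> borel_measurable (Y n)"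
  by (intro along_measurable dens_measurable f0_measurable f1_measurable order_refl)+

lemma Z_measurable[measurable]: "Z n \<in> borel_measurable (Y n)"
  using L_measurable[of n] by (simp add: along_lik_ratio[abs_def])

lemma live_measurable[measurable]: "n \<le> Suc m \<Longrightarrow> live n \<in> borel_measurable (Y m)"
  unfolding live_def[abs_def]
  by (intro borel_measurable_prod borel_measurable_diff borel_measurable_const q_measurable) auto

lemma live_bounds:
  assumes "n \<le> Suc m" "y \<in> space (Y m)"
  shows "0 \<le> live n y"
  unfolding live_def using assms by (intro prod_nonneg) (auto intro!: q_bounds[of _ m y])

lemma L_nonneg:
  assumes y: "y \<in> space (Y n)"
  shows "0 \<le> L f0 n y" "0 \<le> L f1 n y"
proof -
  have "controls chi n y i \<in> space X" "y i \<in> space \<mu>" if "i \<in> {1..n}" for i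
    using measurable_space[OF controls_measurable[OF order_refl] y] y that
    by (auto simp: space_PiM)
  then show "0 \<le> L f0 n y" "0 \<le> L f1 n y"
    unfolding along_def dens_def
    by (auto intro!: prod_nonneg f0_nonneg f1_nonneg)
qed

lemma Z_nonneg: "y \<in> space (Y n) \<Longrightarrow> 0 \<le> Z n y"
  using L_nonneg by (simp add: along_lik_ratio)

lemma h_Z_measurable: "bounded_value h \<Longrightarrow> (\<lambda>y. h (Z n y)) \<in> borel_measurable (Y n)"
  by (rule bounded_value_compose[OF _ Z_measurable Z_nonneg])

text \<open>
  Conditioning on the first \<open>k\<close> responses.  By Tonelli the last response is integrated first; given
  the past, the control is fixed, the response has density \<open>f0\<close>, and the ratio \<open>Z (Suc k)\<close> is \<open>Z k\<close> times the
  ratio of the last densities, so the inner integral is \<open>nv\<close>.  With \<open>h = 0\<close> this is the consistency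
  of the laws of the responses.
\<close>

lemma integrate_last_response:
  assumes h: "bounded_value h" and a: "0 \<le> a"
  shows "(\<integral>\<^sup>+ y. ennreal (live (Suc k) y * L f0 (Suc k) y * (a + h (Z (Suc k) y))) \<partial>Y (Suc k))
       = (\<integral>\<^sup>+ y. ennreal (live (Suc k) y * L f0 k y * (a + nv h (Z k y) (u k y))) \<partial>Y k)"
    (is "?l = ?r")
proof -
  interpret product_sigma_finite "\<lambda>_::nat. \<mu>"
    by (rule product_sigma_finite.intro) (rule sigma_finite)
  let ?F = "\<lambda>y. ennreal (live (Suc k) y * L f0 (Suc k) y * (a + h (Z (Suc k) y)))"
  have [measurable]: "?F \<in> borel_measurable (Y (Suc k))"
    using h_Z_measurable[OF h, of "Suc k"] by measurable
  have ins: "{1..Suc k} = insert (Suc k) {1..k}"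
    by auto
  have "?l = (\<integral>\<^sup>+ y. \<integral>\<^sup>+ v. ?F (y(Suc k := v)) \<partial>\<mu> \<partial>Y k)"
    using product_nn_integral_insert[of "{1..k}" "Suc k" ?F] \<open>?F \<in> _\<close> unfolding ins by simp
  also have "\<dots> = ?r"
  proof (rule nn_integral_cong)
    fix y assume y: "y \<in> space (Y k)"
    let ?A = "live (Suc k) y * L f0 k y" and ?z = "Z k y" and ?x = "u k y"
    have x: "?x \<in> space X" and z: "0 \<le> ?z" and A: "0 \<le> ?A"
      using y u_space Z_nonneg live_bounds[of "Suc k" k] L_nonneg by auto
    let ?G = "\<lambda>v. ?A * (a * f0 v ?x + f0 v ?x * h (?z * (f1 v ?x / f0 v ?x)))"
    \<comment> \<open>The value of \<open>Z (Suc k)\<close> where \<open>f0 v ?x = 0\<close> is harmless: the density multiplies it by \<open>0\<close>.\<close>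
    have "?F (y(Suc k := v)) = ennreal (?G v)" for v
      unfolding along_lik_ratio[of _ "Suc k"] along_dens_Suc live_upd along_upd
      by (simp add: along_lik_ratio algebra_simps)
    then have "(\<integral>\<^sup>+ v. ?F (y(Suc k := v)) \<partial>\<mu>) = (\<integral>\<^sup>+ v. ennreal (?G v) \<partial>\<mu>)"
      by simp
    also have "\<dots> = ennreal (\<integral>v. ?G v \<partial>\<mu>)"
      using A a f0_nonneg[OF x] next_val_integrand_bounds(1)[OF h z x]
        f0_integrable[OF x] next_val_integrable[OF h z x]
      by (intro nn_integral_eq_integral AE_I2 integrable_mult_right Bochner_Integration.integrable_add) auto
    also have "(\<integral>v. ?G v \<partial>\<mu>) = ?A * (a + nv h ?z ?x)"
      using f0_integrable[OF x] next_val_integrable[OF h z x] f0_integral[OF x]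
      by (simp add: next_val_def)
    finally show "(\<integral>\<^sup>+ v. ?F (y(Suc k := v)) \<partial>\<mu>) = ennreal (?A * (a + nv h ?z ?x))" .
  qed
  finally show ?thesis .
qed

section \<open>The cost identity\<close>

text \<open>
  Expected regret, over the paths that reach stage \<open>Suc k\<close>, from not choosing a best control there.
\<close>

definition control_loss :: "nat \<Rightarrow> ennreal" where
  "control_loss k = (\<integral>\<^sup>+ y. ennreal
     (live (Suc k) y * L f0 k y * (nv \<rho> (Z k y) (u k y) - R (Z k y))) \<partial>Y k)"

text \<open>
  Expected regret of the stopping decision at stage \<open>k\<close>: by \<open>rho_lim_fixed_point\<close>, \<open>\<rho>\<close> is the smaller of
  the two costs \<open>g\<close> and \<open>1 + R\<close> between which the rule randomizes.
\<close>

definition stop_loss :: "nat \<Rightarrow> ennreal" where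
  "stop_loss k = (\<integral>\<^sup>+ y. ennreal (live k y * L f0 k y *
     (q k y * g (Z k y) + (1 - q k y) * (1 + R (Z k y)) - \<rho> (Z k y))) \<partial>Y k)"

text \<open>
  Paths that stop at stage \<open>k\<close> have paid for \<open>k\<close> observations and incur the terminal loss \<open>g\<close>.
\<close>

definition stop_cost :: "nat \<Rightarrow> ennreal" where
  "stop_cost k = (\<integral>\<^sup>+ y. ennreal (live k y * q k y * L f0 k y * (k + g (Z k y))) \<partial>Y k)"

text \<open>
  Paths that go on after stage \<open>k\<close> are charged for the first \<open>k + 1\<close> observations and for an optimal
  behaviour from then on.
\<close>

definition cont_cost :: "nat \<Rightarrow> ennreal" where
  "cont_cost k = (\<integral>\<^sup>+ y. ennreal (live (Suc k) y * L f0 k y * (Suc k + R (Z k y))) \<partial>Y k)"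

text \<open>
  The probability under \<open>\<theta>\<^sub>0\<close> that more than \<open>k\<close> observations are taken.
\<close>

definition survival :: "nat \<Rightarrow> ennreal" where
  "survival k = (\<integral>\<^sup>+ y. ennreal (live (Suc k) y * L f0 k y) \<partial>Y k)"

abbreviation "p n \<equiv> prob_stop \<mu> f0 chi psi n"

lemma g_bounded: "bounded_value g"
  using rhok_bounded[of 0] by simp

lemma weight_measurable [measurable]:
  "(\<lambda>y. live (Suc k) y * L f0 k y) \<in> borel_measurable (Y k)"
  "1 \<le> k \<Longrightarrow> (\<lambda>y. live k y * L f0 k y) \<in> borel_measurable (Y k)"
  "1 \<le> k \<Longrightarrow> (\<lambda>y. live k y * q k y * L f0 k y) \<in> borel_measurable (Y k)"
  by (intro borel_measurable_times live_measurable L_measurable q_measurable; simp)+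

lemma weight_nonneg:
  assumes y: "y \<in> space (Y k)"
  shows "0 \<le> live (Suc k) y * L f0 k y" "0 \<le> live k y * L f0 k y"
    "1 \<le> k \<Longrightarrow> 0 \<le> live k y * q k y * L f0 k y"
  using live_bounds[of "Suc k" k y] live_bounds[of k k y] L_nonneg[OF y] q_bounds[of k k y] y
  by simp_all

lemma bounded_value_Z:
  assumes "bounded_value h" "y \<in> space (Y k)"
  shows "0 \<le> h (Z k y)" "h (Z k y) \<le> lam0"
  using assms Z_nonneg by (auto simp: bounded_value_def)

lemma nv_Z_measurable [measurable]: "(\<lambda>y. nv \<rho> (Z k y) (u k y)) \<in> borel_measurable (Y k)"
  by (intro next_val_measurable rho_lim_bounded Z_measurable Z_nonneg u_measurable order_refl)

lemmas Z_funs_measurable [measurable] =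
  h_Z_measurable[OF g_bounded] h_Z_measurable[OF rho_lim_bounded] h_Z_measurable[OF R_bounded]

lemma R_le_nv: "y \<in> space (Y k) \<Longrightarrow> R (Z k y) \<le> nv \<rho> (Z k y) (u k y)"
  by (intro R_le Z_nonneg u_space)

lemma rho_lim_Z_le:
  assumes y: "y \<in> space (Y k)" and k: "1 \<le> k"
  shows "\<rho> (Z k y) \<le> q k y * g (Z k y) + (1 - q k y) * (1 + R (Z k y))"
proof -
  have q: "0 \<le> q k y" "q k y \<le> 1"
    using q_bounds[OF k order_refl y] by auto
  let ?m = "min (g (Z k y)) (1 + R (Z k y))"
  have "q k y * ?m + (1 - q k y) * ?m \<le> q k y * g (Z k y) + (1 - q k y) * (1 + R (Z k y))"
    using q by (intro add_mono mult_left_mono) auto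
  moreover have "q k y * ?m + (1 - q k y) * ?m = ?m"
    by (simp add: left_diff_distrib)
  ultimately show ?thesis
    using rho_lim_fixed_point[OF Z_nonneg[OF y]] by simp
qed

text \<open>
  Paying for the actual control instead of the best one adds \<open>control_loss\<close> and replaces \<open>R (Z k)\<close>
  by \<open>nv \<rho> (Z k) (u k)\<close>; by \<open>integrate_last_response\<close> this is the mean of \<open>\<rho> (Z (Suc k))\<close>.  Paying for the actual stopping
  decision adds \<open>stop_loss\<close> and splits \<open>\<rho> (Z (Suc k))\<close> into a stopping and a continuation part.
  All terms are nonnegative, so the identity holds in \<open>ennreal\<close> without subtraction.
\<close>

lemma cost_step:
  "cont_cost k + control_loss k + stop_loss (Suc k) = stop_cost (Suc k) + cont_cost (Suc k)"
proof -
  have [measurable]: "q (Suc k) \<in> borel_measurable (Y (Suc k))"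
    by (rule q_measurable) auto
  have [measurable]: "live (Suc k) \<in> borel_measurable (Y (Suc k))"
    "live (Suc k) \<in> borel_measurable (Y k)" "live (Suc (Suc k)) \<in> borel_measurable (Y (Suc k))"
    by (rule live_measurable; simp)+
  have "cont_cost k + control_loss k
      = (\<integral>\<^sup>+ y. ennreal (live (Suc k) y * L f0 k y * (Suc k + nv \<rho> (Z k y) (u k y))) \<partial>Y k)"
    unfolding cont_cost_def control_loss_def
  proof (rule nn_integral_add_ennreal[symmetric])
    show "0 \<le> live (Suc k) y * L f0 k y * (Suc k + R (Z k y))" if "y \<in> space (Y k)" for y
      using weight_nonneg(1)[OF that] bounded_value_Z[OF R_bounded that] by simp
    show "0 \<le> live (Suc k) y * L f0 k y * (nv \<rho> (Z k y) (u k y) - R (Z k y))"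
      if "y \<in> space (Y k)" for y
      using weight_nonneg(1)[OF that] R_le_nv[OF that] by simp
  qed (measurable, simp add: algebra_simps)
  also have "\<dots> = (\<integral>\<^sup>+ y. ennreal (live (Suc k) y * L f0 (Suc k) y * (Suc k + \<rho> (Z (Suc k) y)))
      \<partial>Y (Suc k))"
    by (rule integrate_last_response[symmetric]) (auto intro: rho_lim_bounded)
  finally have "cont_cost k + control_loss k = \<dots>" .
  then have "cont_cost k + control_loss k + stop_loss (Suc k)
      = (\<integral>\<^sup>+ y. ennreal (live (Suc k) y * L f0 (Suc k) y * (Suc k + (q (Suc k) y * g (Z (Suc k) y)
          + (1 - q (Suc k) y) * (1 + R (Z (Suc k) y))))) \<partial>Y (Suc k))"
    unfolding stop_loss_def
  proof (simp only:, intro nn_integral_add_ennreal[symmetric])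
    fix y assume y: "y \<in> space (Y (Suc k))"
    show "0 \<le> live (Suc k) y * L f0 (Suc k) y * (Suc k + \<rho> (Z (Suc k) y))"
      using weight_nonneg(2)[OF y] bounded_value_Z[OF rho_lim_bounded y] by simp
    show "0 \<le> live (Suc k) y * L f0 (Suc k) y * (q (Suc k) y * g (Z (Suc k) y)
        + (1 - q (Suc k) y) * (1 + R (Z (Suc k) y)) - \<rho> (Z (Suc k) y))"
      using weight_nonneg(2)[OF y] rho_lim_Z_le[OF y] by simp
  qed (measurable, simp add: algebra_simps)
  also have "\<dots> = stop_cost (Suc k) + cont_cost (Suc k)"
    unfolding stop_cost_def cont_cost_def
  proof (rule nn_integral_add_ennreal)
    fix y assume y: "y \<in> space (Y (Suc k))"
    show "0 \<le> live (Suc k) y * q (Suc k) y * L f0 (Suc k) y * (Suc k + g (Z (Suc k) y))"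
      using weight_nonneg(3)[OF y] bounded_value_Z[OF g_bounded y] by simp
    show "0 \<le> live (Suc (Suc k)) y * L f0 (Suc k) y * (Suc (Suc k) + R (Z (Suc k) y))"
      using weight_nonneg(1)[OF y] bounded_value_Z[OF R_bounded y] by simp
  qed (measurable, simp add: algebra_simps live_Suc)
  finally show ?thesis .
qed

text \<open>
  The empty product space is a single point of mass \<open>1\<close>, so that stage \<open>0\<close> need not be treated apart.
\<close>

lemma integral_no_responses: "integral\<^sup>N (Y 0) f = f (\<lambda>_. undefined)"
proof -
  interpret product_sigma_finite "\<lambda>_::nat. \<mu>"
    by (rule product_sigma_finite.intro) (rule sigma_finite)
  have "{1..0::nat} = {}" by simp
  then show ?thesis using nn_integral_empty[of f] by simp
qed

lemma cont_cost_0: "cont_cost 0 = ennreal (1 + R 1)"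
  unfolding cont_cost_def integral_no_responses
  by (simp add: live_1 along_def dens_def lik_ratio_def)

lemma cost_telescope:
  "(\<Sum>n<k. stop_cost (Suc n)) + cont_cost k
     = ennreal (1 + R 1) + (\<Sum>n<k. control_loss n + stop_loss (Suc n))"
proof (induction k)
  case 0
  then show ?case by (simp add: cont_cost_0)
next
  case (Suc k)
  have "(\<Sum>n<Suc k. stop_cost (Suc n)) + cont_cost (Suc k)
      = ((\<Sum>n<k. stop_cost (Suc n)) + cont_cost k) + (control_loss k + stop_loss (Suc k))"
    using cost_step[of k] by (simp add: add.assoc)
  then show ?case
    by (simp only: Suc.IH sum.lessThan_Suc add.assoc)
qed

lemma prob_stop_eq: "p n = (\<integral>\<^sup>+ y. ennreal (live n y * q n y * L f0 n y) \<partial>Y n)"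
proof -
  have "along chi n (\<lambda>x y. reach psi n x y * psi n x y) y = live n y * q n y" for y
    using along_reach[of n n y] by (simp add: along_def)
  then show ?thesis by (simp add: prob_stop_def expect_def)
qed

lemma survival_step: "survival k = p (Suc k) + survival (Suc k)"
proof -
  have [measurable]: "q (Suc k) \<in> borel_measurable (Y (Suc k))"
    by (rule q_measurable) auto
  have [measurable]: "live (Suc k) \<in> borel_measurable (Y (Suc k))"
    "live (Suc (Suc k)) \<in> borel_measurable (Y (Suc k))"
    by (rule live_measurable; simp)+
  have "bounded_value (\<lambda>_. 0)"
    using lam0_pos by (simp add: bounded_value_def)
  from integrate_last_response[OF this, of 1 k]
  have "survival k = (\<integral>\<^sup>+ y. ennreal (live (Suc k) y * L f0 (Suc k) y) \<partial>Y (Suc k))"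
    by (simp add: survival_def next_val_def)
  also have "\<dots> = p (Suc k) + survival (Suc k)"
    unfolding prob_stop_eq survival_def
  proof (rule nn_integral_add_ennreal)
    show "0 \<le> live (Suc k) y * q (Suc k) y * L f0 (Suc k) y" if "y \<in> space (Y (Suc k))" for y
      using weight_nonneg(3)[OF that] by simp
    show "0 \<le> live (Suc (Suc k)) y * L f0 (Suc k) y" if "y \<in> space (Y (Suc k))" for y
      using weight_nonneg(1)[OF that] by simp
  qed (measurable, simp add: algebra_simps live_Suc)
  finally show ?thesis .
qed

lemma survival_0: "survival 0 = 1"
  unfolding survival_def integral_no_responses
  by (simp add: live_1 along_def dens_def)

lemma survival_telescope: "(\<Sum>n<k. p (Suc n)) + survival k = 1"
proof (induction k)
  case (Suc k)
  then show ?case using survival_step[of k] by (simp add: add.assoc)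
qed (simp add: survival_0)

text \<open>
  The cost of continuing is squeezed between multiples of \<open>(k + 1) P(\<tau> > k)\<close>.  The lower bound shows
  that a bounded cost forces stopping; the upper one, with \<open>mean_tail_tendsto_0\<close>, shows that
  the cost of continuing disappears in the limit.
\<close>

lemma cont_cost_ge: "of_nat (Suc k) * survival k \<le> cont_cost k"
proof -
  have "of_nat (Suc k) * survival k = (\<integral>\<^sup>+ y. of_nat (Suc k) * ennreal (live (Suc k) y * L f0 k y) \<partial>Y k)"
    unfolding survival_def
    by (subst nn_integral_cmult)
       (rule measurable_compose[OF weight_measurable(1) measurable_ennreal], rule refl)
  also have "\<dots> \<le> cont_cost k"
    unfolding cont_cost_def
  proof (rule nn_integral_mono)
    fix y assume y: "y \<in> space (Y k)"
    show "of_nat (Suc k) * ennreal (live (Suc k) y * L f0 k y)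
        \<le> ennreal (live (Suc k) y * L f0 k y * (Suc k + R (Z k y)))"
      using mult_left_mono[OF _ weight_nonneg(1)[OF y], of "Suc k" "Suc k + R (Z k y)"]
        weight_nonneg(1)[OF y] bounded_value_Z[OF R_bounded y]
      by (subst ennreal_of_nat_eq_real_of_nat, subst ennreal_mult''[symmetric])
         (auto intro!: ennreal_leI simp: mult.commute simp del: of_nat_Suc)
  qed
  finally show ?thesis .
qed

lemma cont_cost_le: "cont_cost k \<le> ennreal (1 + lam0) * (of_nat (Suc k) * survival k)"
proof -
  have "cont_cost k \<le> (\<integral>\<^sup>+ y. ennreal ((1 + lam0) * Suc k) * ennreal (live (Suc k) y * L f0 k y) \<partial>Y k)"
    unfolding cont_cost_def
  proof (rule nn_integral_mono)
    fix y assume y: "y \<in> space (Y k)"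
    have "Suc k + R (Z k y) \<le> (1 + lam0) * Suc k"
      using bounded_value_Z[OF R_bounded y] add_increasing2[of "lam0 * k" "R (Z k y)" lam0] lam0_pos
      by (simp add: algebra_simps)
    then have "live (Suc k) y * L f0 k y * (Suc k + R (Z k y))
        \<le> (1 + lam0) * Suc k * (live (Suc k) y * L f0 k y)"
      using weight_nonneg(1)[OF y] mult_left_mono by (metis mult.commute)
    then show "ennreal (live (Suc k) y * L f0 k y * (Suc k + R (Z k y)))
        \<le> ennreal ((1 + lam0) * Suc k) * ennreal (live (Suc k) y * L f0 k y)"
      using lam0_pos by (subst ennreal_mult''[symmetric]) (auto intro!: ennreal_leI weight_nonneg y)
  qed
  also have "\<dots> = ennreal ((1 + lam0) * Suc k) * survival k"
    unfolding survival_def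
    by (subst nn_integral_cmult)
       (rule measurable_compose[OF weight_measurable(1) measurable_ennreal], rule refl)
  also have "\<dots> = ennreal (1 + lam0) * (of_nat (Suc k) * survival k)"
    using lam0_pos by (simp add: ennreal_mult ennreal_of_nat_eq_real_of_nat mult.assoc)
  finally show ?thesis .
qed

lemma survival_tendsto_0:
  assumes "(\<Sum>n. p (Suc n)) = 1"
  shows "survival \<longlonglongrightarrow> 0"
proof -
  have "survival = (\<lambda>k. 1 - (\<Sum>n<k. p (Suc n)))"
    by (rule ext, use survival_telescope in
        \<open>metis ennreal_add_diff_cancel_left ennreal_one_neq_top le_iff_add neq_top_trans\<close>)
  moreover have "(\<lambda>k. 1 - (\<Sum>n<k. p (Suc n))) \<longlonglongrightarrow> 1 - 1"
    using summable_LIMSEQ[OF summableI, of "\<lambda>n. p (Suc n)"] assms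
    by (intro tendsto_diff_ennreal) auto
  ultimately show ?thesis by simp
qed

lemma prob_stop_sums_1:
  assumes "survival \<longlonglongrightarrow> 0"
  shows "(\<Sum>n. p (Suc n)) = 1"
proof -
  have "(\<lambda>k. (\<Sum>n<k. p (Suc n)) + survival k) \<longlonglongrightarrow> (\<Sum>n. p (Suc n)) + 0"
    by (intro tendsto_add summable_LIMSEQ summableI assms)
  then show ?thesis
    by (simp add: survival_telescope LIMSEQ_const_iff)
qed

text \<open>
  The usual tail estimate \<open>(k + 1) P(\<tau> > k) \<le> E(\<tau>; \<tau> > k)\<close>: mass that is still alive after stage \<open>k\<close>
  contributes at least \<open>k + 1\<close> to the mean once it stops, and by the first assumption all of it
  eventually does.
\<close>

lemma mean_tail_tendsto_0:
  assumes surv: "survival \<longlonglongrightarrow> 0" and fin: "(\<Sum>n. of_nat (Suc n) * p (Suc n)) < \<infinity>"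
  shows "(\<lambda>k. of_nat (Suc k) * survival k) \<longlonglongrightarrow> 0"
proof -
  let ?S = "\<lambda>k. \<Sum>n<k. of_nat (Suc n) * p (Suc n)" and ?N = "\<Sum>n. of_nat (Suc n) * p (Suc n)"
  have lim: "?S \<longlonglongrightarrow> ?N"
    by (intro summable_LIMSEQ summableI)
  \<comment> \<open>Moving the mass that stops at stage \<open>k + j + 1\<close> from the second term to the first one only raises its weight.\<close>
  have step: "?S k + of_nat (Suc k) * survival k \<le> ?S (k + j) + of_nat (Suc k) * survival (k + j)" for k j
  proof (induction j)
    case (Suc j)
    have "of_nat (Suc k) * p (Suc (k + j)) \<le> of_nat (Suc (k + j)) * p (Suc (k + j))"
      by (intro mult_right_mono) (auto simp del: of_nat_Suc)
    then have "of_nat (Suc k) * survival (k + j)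
        \<le> of_nat (Suc (k + j)) * p (Suc (k + j)) + of_nat (Suc k) * survival (Suc (k + j))"
      unfolding survival_step[of "k + j"] distrib_left by (intro add_right_mono)
    with Suc.IH show ?case
      by (simp add: add.assoc del: of_nat_Suc) (meson add_left_mono order_trans)
  qed simp
  have le: "?S k + of_nat (Suc k) * survival k \<le> ?N" for k
  proof (rule LIMSEQ_le_const)
    have "(\<lambda>j. ?S (k + j) + of_nat (Suc k) * survival (k + j)) \<longlonglongrightarrow> ?N + of_nat (Suc k) * 0"
      using LIMSEQ_ignore_initial_segment[OF lim, of k] LIMSEQ_ignore_initial_segment[OF surv, of k]
      by (intro tendsto_add ennreal_tendsto_cmult) (auto simp: add.commute ennreal_of_nat_eq_real_of_nat)
    then show "(\<lambda>j. ?S (k + j) + of_nat (Suc k) * survival (k + j)) \<longlonglongrightarrow> ?N"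
      by simp
  qed (use step in auto)
  have "of_nat (Suc k) * survival k \<le> ?N - ?S k" for k
  proof -
    have "?S k \<le> ?S k + of_nat (Suc k) * survival k"
      unfolding le_iff_add by blast
    also note le[of k]
    also note fin
    finally have "?S k \<noteq> top"
      unfolding infinity_ennreal_def by (rule less_imp_neq)
    then show ?thesis
      using le[of k] by (intro ennreal_le_diff)
  qed
  note bound = this
  have "(\<lambda>k. ?N - ?S k) \<longlonglongrightarrow> ?N - ?N"
    using fin by (intro tendsto_diff_ennreal_general tendsto_const lim) simp
  then have "(\<lambda>k. ?N - ?S k) \<longlonglongrightarrow> 0"
    using fin by (simp only: ennreal_diff_self less_irrefl not_False_eq_True infinity_ennreal_def less_top)
  then show ?thesis
    by (rule tendsto_sandwich[OF _ _ tendsto_const, rotated 2])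
       (intro always_eventually allI zero_le bound)+
qed

section \<open>The optimality conditions as vanishing losses\<close>

lemma AE_obs_law:
  "(AE y in obs_law \<mu> f0 chi k. P y) \<longleftrightarrow> (AE y in Y k. 0 < L f0 k y \<longrightarrow> P y)"
  unfolding obs_law_def
  by (subst AE_density[OF measurable_compose[OF L_measurable(1) measurable_ennreal]]) simp

text \<open>
  Both factors of the weight in the integrand are nonnegative, and the condition is demanded exactly
  where both are positive.
\<close>

lemma control_cond_iff:
  "control_cond X \<mu> f0 f1 lam0 lam1 chi psi k \<longleftrightarrow> control_loss k = 0"
proof -
  have "control_loss k = 0 \<longleftrightarrow>
      (AE y in Y k. live (Suc k) y * L f0 k y * (nv \<rho> (Z k y) (u k y) - R (Z k y)) = 0)"
    unfolding control_loss_def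
  proof (rule nn_integral_ennreal_0_iff)
    show "0 \<le> live (Suc k) y * L f0 k y * (nv \<rho> (Z k y) (u k y) - R (Z k y))"
      if "y \<in> space (Y k)" for y
      using weight_nonneg(1)[OF that] R_le_nv[OF that] by simp
  qed measurable
  also have "\<dots> \<longleftrightarrow> (AE y in Y k. 0 < L f0 k y \<longrightarrow> 0 < live (Suc k) y \<longrightarrow>
      nv \<rho> (Z k y) (u k y) = R (Z k y))"
  proof (rule AE_cong)
    fix y assume y: "y \<in> space (Y k)"
    show "live (Suc k) y * L f0 k y * (nv \<rho> (Z k y) (u k y) - R (Z k y)) = 0 \<longleftrightarrow>
        (0 < L f0 k y \<longrightarrow> 0 < live (Suc k) y \<longrightarrow> nv \<rho> (Z k y) (u k y) = R (Z k y))"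
      using live_bounds[OF order_refl y] L_nonneg(1)[OF y] by (auto simp: less_le)
  qed
  finally show ?thesis
    unfolding control_cond_def AE_obs_law Let_def along_reach[OF order_refl] by simp
qed

text \<open>
  The condition on the first control is the condition on the next control at the empty history.
\<close>

lemma init_cond_iff: "init_cond X \<mu> f0 f1 lam0 lam1 chi \<longleftrightarrow> control_loss 0 = 0"
proof -
  have [simp]: "Z 0 y = 1" "u 0 (\<lambda>_. undefined) = chi 1 (\<lambda>_. undefined) (\<lambda>_. undefined)" for y
    by (simp_all add: along_def lik_ratio_def)
  have "(\<lambda>_. undefined) \<in> space (Y 0)"
    by (simp add: space_PiM_empty)
  from R_le_nv[OF this] have "R 1 \<le> nv \<rho> 1 (chi 1 (\<lambda>_. undefined) (\<lambda>_. undefined))"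
    by simp
  moreover have "control_loss 0 = ennreal (nv \<rho> 1 (chi 1 (\<lambda>_. undefined) (\<lambda>_. undefined)) - R 1)"
    unfolding control_loss_def integral_no_responses
    by (simp add: live_1) (simp add: along_def dens_def)
  ultimately show ?thesis
    unfolding init_cond_def by (auto simp: ennreal_eq_0_iff)
qed

lemma stop_cond_iff:
  assumes k: "1 \<le> k"
  shows "stop_cond X \<mu> f0 f1 lam0 lam1 chi psi k \<longleftrightarrow> stop_loss k = 0"
proof -
  let ?S = "\<lambda>y. q k y * g (Z k y) + (1 - q k y) * (1 + R (Z k y))"
  let ?C = "\<lambda>y. of_bool (g (Z k y) < 1 + R (Z k y)) \<le> q k y \<and> q k y \<le> of_bool (g (Z k y) \<le> 1 + R (Z k y))"
  have [measurable]: "q k \<in> borel_measurable (Y k)" "live k \<in> borel_measurable (Y k)"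
    by (rule q_measurable[OF k order_refl], rule live_measurable) simp
  have "stop_loss k = 0 \<longleftrightarrow> (AE y in Y k. live k y * L f0 k y * (?S y - \<rho> (Z k y)) = 0)"
    unfolding stop_loss_def
  proof (rule nn_integral_ennreal_0_iff)
    show "0 \<le> live k y * L f0 k y * (?S y - \<rho> (Z k y))" if "y \<in> space (Y k)" for y
      using weight_nonneg(2)[OF that] rho_lim_Z_le[OF that k] by simp
  qed measurable
  also have "\<dots> \<longleftrightarrow> (AE y in Y k. 0 < L f0 k y \<longrightarrow> 0 < live k y \<longrightarrow> ?C y)"
  proof (rule AE_cong)
    fix y assume y: "y \<in> space (Y k)"
    have "?S y = \<rho> (Z k y) \<longleftrightarrow> ?C y"
      unfolding rho_lim_fixed_point[OF Z_nonneg[OF y]]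
      by (rule randomized_choice_optimal_iff) (use q_bounds[OF k order_refl y] in auto)
    moreover have "0 \<le> live k y"
      by (rule live_bounds[of k k]) (use y in auto)
    ultimately show "live k y * L f0 k y * (?S y - \<rho> (Z k y)) = 0 \<longleftrightarrow>
        (0 < L f0 k y \<longrightarrow> 0 < live k y \<longrightarrow> ?C y)"
      using L_nonneg(1)[OF y] by (auto simp: less_le)
  qed
  moreover have "along chi k (reach psi k) y = live k y" for y
    by (rule along_reach) simp
  ultimately show ?thesis
    unfolding stop_cond_def AE_obs_law Let_def by simp
qed

section \<open>Error probabilities and the weighted cost\<close>

lemma stage_cost:
  assumes phi: "randomized_rule X \<mu> phi" and n: "1 \<le> n"
  shows "of_nat n * p n
      + ennreal lam0 * expect \<mu> f0 chi n (\<lambda>x y. reach psi n x y * psi n x y * phi n x y)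
      + ennreal lam1 * expect \<mu> f1 chi n (\<lambda>x y. reach psi n x y * psi n x y * (1 - phi n x y))
    = (\<integral>\<^sup>+ y. ennreal (live n y * q n y * (n * L f0 n y + lam0 * (along chi n (phi n) y * L f0 n y)
         + lam1 * ((1 - along chi n (phi n) y) * L f1 n y))) \<partial>Y n)"
    (is "?N + ?A + ?B = ?r")
proof -
  have [measurable]: "q n \<in> borel_measurable (Y n)" "live n \<in> borel_measurable (Y n)"
    by (rule q_measurable[OF n order_refl], rule live_measurable) simp
  have [measurable]: "along chi n (phi n) \<in> borel_measurable (Y n)"
    using phi n by (intro along_measurable) (auto simp: randomized_rule_def)
  let ?w = "\<lambda>y. live n y * q n y" and ?ph = "along chi n (phi n)"
  have along_simps: "along chi n (\<lambda>x y. reach psi n x y * psi n x y * phi n x y) y = ?w y * ?ph y"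
    "along chi n (\<lambda>x y. reach psi n x y * psi n x y * (1 - phi n x y)) y = ?w y * (1 - ?ph y)" for y
    using along_reach[of n n y] by (simp_all add: along_def)
  have pos: "0 \<le> ?w y" "0 \<le> ?ph y" "?ph y \<le> 1" "0 \<le> L f0 n y" "0 \<le> L f1 n y"
    if "y \<in> space (Y n)" for y
    using that live_bounds[of n n y] q_bounds[OF n order_refl that] L_nonneg[OF that]
      along_rule_bounds[OF phi n order_refl that] by auto
  have N: "?N = (\<integral>\<^sup>+ y. ennreal (?w y * (n * L f0 n y)) \<partial>Y n)"
    unfolding prob_stop_eq
    by (subst nn_integral_cmult[symmetric]; (measurable)?)
       (auto intro!: nn_integral_cong simp: ennreal_of_nat_eq_real_of_nat ennreal_mult'[symmetric] ac_simps)
  have A: "?A = (\<integral>\<^sup>+ y. ennreal (?w y * (lam0 * (?ph y * L f0 n y))) \<partial>Y n)"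
    unfolding expect_def along_simps using lam0_pos
    by (subst nn_integral_cmult[symmetric]; (measurable)?)
       (auto intro!: nn_integral_cong simp: ennreal_mult'[symmetric] ac_simps)
  have B: "?B = (\<integral>\<^sup>+ y. ennreal (?w y * (lam1 * ((1 - ?ph y) * L f1 n y))) \<partial>Y n)"
    unfolding expect_def along_simps using lam1_pos
    by (subst nn_integral_cmult[symmetric]; (measurable)?)
       (auto intro!: nn_integral_cong simp: ennreal_mult'[symmetric] ac_simps)
  let ?n = "\<lambda>y. n * L f0 n y" and ?a = "\<lambda>y. lam0 * (?ph y * L f0 n y)"
    and ?b = "\<lambda>y. lam1 * ((1 - ?ph y) * L f1 n y)"
  have nonneg: "0 \<le> ?n y" "0 \<le> ?a y" "0 \<le> ?b y" if "y \<in> space (Y n)" for y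
    using pos(2-5)[OF that] lam0_pos lam1_pos by simp_all
  have "?N + ?A = (\<integral>\<^sup>+ y. ennreal (?w y * (?n y + ?a y)) \<partial>Y n)"
    unfolding N A
  proof (rule nn_integral_add_ennreal[symmetric])
    fix y assume y: "y \<in> space (Y n)"
    show "0 \<le> ?w y * ?n y" "0 \<le> ?w y * ?a y"
      by (intro mult_nonneg_nonneg[OF pos(1)] nonneg y)+
    show "?w y * (?n y + ?a y) = ?w y * ?n y + ?w y * ?a y"
      by (rule distrib_left)
  qed measurable
  then show ?thesis
    unfolding B
  proof (simp only:, intro nn_integral_add_ennreal[symmetric])
    fix y assume y: "y \<in> space (Y n)"
    show "0 \<le> ?w y * (?n y + ?a y)" "0 \<le> ?w y * ?b y"
      by (intro mult_nonneg_nonneg[OF pos(1)] add_nonneg_nonneg nonneg y)+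
    show "?w y * (?n y + ?a y + ?b y) = ?w y * (?n y + ?a y) + ?w y * ?b y"
      by (rule distrib_left)
  qed measurable
qed

text \<open>
  Where \<open>L f0 n = 0\<close> the ratio \<open>Z n\<close> is a dummy value, but both sides are \<open>0\<close>.
\<close>

lemma g_times_density:
  "y \<in> space (Y n) \<Longrightarrow> L f0 n y * g (Z n y) = min (lam0 * L f0 n y) (lam1 * L f1 n y)"
  using L_nonneg[of y n] lam1_pos
  by (cases "L f0 n y = 0") (auto simp: gfun_def along_lik_ratio min_mult_distrib_left ac_simps)

text \<open>
  A decision rule mixes the two losses \<open>lam0 * f0\<close> and \<open>lam1 * f1\<close>, and no mixture is below their
  minimum; the likelihood ratio test always picks the minimum.
\<close>

lemma stop_cost_le:
  assumes phi: "randomized_rule X \<mu> phi" and n: "1 \<le> n"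
  shows "stop_cost n \<le> of_nat n * p n
      + ennreal lam0 * expect \<mu> f0 chi n (\<lambda>x y. reach psi n x y * psi n x y * phi n x y)
      + ennreal lam1 * expect \<mu> f1 chi n (\<lambda>x y. reach psi n x y * psi n x y * (1 - phi n x y))"
  unfolding stage_cost[OF assms] stop_cost_def
proof (intro nn_integral_mono ennreal_leI)
  fix y assume y: "y \<in> space (Y n)"
  let ?ph = "along chi n (phi n) y" and ?m = "min (lam0 * L f0 n y) (lam1 * L f1 n y)"
  have ph: "0 \<le> ?ph" "?ph \<le> 1"
    using along_rule_bounds[OF phi n order_refl y] by auto
  have "?ph * ?m + (1 - ?ph) * ?m \<le> ?ph * (lam0 * L f0 n y) + (1 - ?ph) * (lam1 * L f1 n y)"
    using ph by (intro add_mono mult_left_mono) auto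
  then have "?m \<le> ?ph * (lam0 * L f0 n y) + (1 - ?ph) * (lam1 * L f1 n y)"
    by (simp add: left_diff_distrib)
  moreover have "0 \<le> live n y * q n y"
    using live_bounds[of n n y] q_bounds[OF n order_refl y] y by simp
  ultimately have "live n y * q n y * (n * L f0 n y + L f0 n y * g (Z n y))
      \<le> live n y * q n y * (n * L f0 n y + (?ph * (lam0 * L f0 n y) + (1 - ?ph) * (lam1 * L f1 n y)))"
    unfolding g_times_density[OF y] by (intro mult_left_mono add_left_mono)
  then show "live n y * q n y * L f0 n y * (n + g (Z n y))
      \<le> live n y * q n y * (n * L f0 n y + lam0 * (?ph * L f0 n y) + lam1 * ((1 - ?ph) * L f1 n y))"
    by (simp add: algebra_simps)
qed

lemma stop_cost_eq:
  assumes n: "1 \<le> n"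
  shows "stop_cost n = of_nat n * p n
      + ennreal lam0 * expect \<mu> f0 chi n (\<lambda>x y. reach psi n x y * psi n x y * lr_test n x y)
      + ennreal lam1 * expect \<mu> f1 chi n (\<lambda>x y. reach psi n x y * psi n x y * (1 - lr_test n x y))"
  unfolding stage_cost[OF lr_test_rule n] stop_cost_def
proof (intro nn_integral_cong arg_cong[of _ _ ennreal])
  fix y assume y: "y \<in> space (Y n)"
  have "lam0 * (along chi n (lr_test n) y * L f0 n y) + lam1 * ((1 - along chi n (lr_test n) y) * L f1 n y)
      = L f0 n y * g (Z n y)"
    unfolding g_times_density[OF y] by (auto simp: along_def lr_test_def)
  then show "live n y * q n y * L f0 n y * (n + g (Z n y))
      = live n y * q n y * (n * L f0 n y + lam0 * (along chi n (lr_test n) y * L f0 n y)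
         + lam1 * ((1 - along chi n (lr_test n) y) * L f1 n y))"
    by (simp add: algebra_simps)
qed

abbreviation "weighted_cost phi \<equiv> avg_sample_number \<mu> f0 chi psi
  + ennreal lam0 * err_alpha \<mu> f0 chi psi phi + ennreal lam1 * err_beta \<mu> f1 chi psi phi"

lemma weighted_cost_suminf:
  assumes "(\<Sum>n. p (Suc n)) = 1"
  shows "weighted_cost phi = (\<Sum>m. let n = Suc m in of_nat n * p n
      + ennreal lam0 * expect \<mu> f0 chi n (\<lambda>x y. reach psi n x y * psi n x y * phi n x y)
      + ennreal lam1 * expect \<mu> f1 chi n (\<lambda>x y. reach psi n x y * psi n x y * (1 - phi n x y)))"
  using assms unfolding avg_sample_number_def err_alpha_def err_beta_def Let_def
  by (simp only: if_True simp_thms ennreal_suminf_cmult[symmetric] suminf_add[OF summableI summableI])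

text \<open>
  Since the cost of continuing tends to \<open>0\<close>, the cost identity holds in the limit \<open>k \<rightarrow> \<infinity>\<close>, where the
  stopping costs are a lower bound for the weighted cost by \<open>stop_cost_le\<close>.
\<close>

lemma weighted_cost_ge:
  assumes phi: "randomized_rule X \<mu> phi" and fin: "avg_sample_number \<mu> f0 chi psi < \<infinity>"
  shows "ennreal (1 + R 1) + (\<Sum>n. control_loss n + stop_loss (Suc n)) \<le> weighted_cost phi"
proof -
  have one: "(\<Sum>n. p (Suc n)) = 1" and mean: "(\<Sum>n. of_nat (Suc n) * p (Suc n)) < \<infinity>"
    using fin by (auto simp: avg_sample_number_def split: if_splits)
  have "(\<lambda>k. ennreal (1 + lam0) * (of_nat (Suc k) * survival k)) \<longlonglongrightarrow> ennreal (1 + lam0) * 0"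
    by (intro ennreal_tendsto_cmult mean_tail_tendsto_0 survival_tendsto_0 one mean) simp
  then have "(\<lambda>k. ennreal (1 + lam0) * (of_nat (Suc k) * survival k)) \<longlonglongrightarrow> 0"
    by (simp only: mult_zero_right)
  then have "cont_cost \<longlonglongrightarrow> 0"
    by (rule tendsto_sandwich[OF _ _ tendsto_const, rotated 2])
       (intro always_eventually allI zero_le cont_cost_le)+
  then have "(\<lambda>k. (\<Sum>n<k. stop_cost (Suc n)) + cont_cost k) \<longlonglongrightarrow> (\<Sum>n. stop_cost (Suc n)) + 0"
    by (intro tendsto_add summable_LIMSEQ summableI)
  moreover have "(\<lambda>k. ennreal (1 + R 1) + (\<Sum>n<k. control_loss n + stop_loss (Suc n)))
      \<longlonglongrightarrow> ennreal (1 + R 1) + (\<Sum>n. control_loss n + stop_loss (Suc n))"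
    by (intro tendsto_add tendsto_const summable_LIMSEQ summableI)
  ultimately have "ennreal (1 + R 1) + (\<Sum>n. control_loss n + stop_loss (Suc n)) = (\<Sum>n. stop_cost (Suc n))"
    unfolding cost_telescope by (simp add: LIMSEQ_unique)
  also have "\<dots> \<le> weighted_cost phi"
    unfolding weighted_cost_suminf[OF one] Let_def
    by (intro suminf_le summableI stop_cost_le phi) simp
  finally show ?thesis .
qed

text \<open>
  Without losses the cost identity keeps the cost of continuing below \<open>1 + R 1\<close>.  As this cost is at
  least \<open>(k + 1) P(\<tau> > k)\<close>, the strategy stops almost surely, so that \<open>N\<close> is given by the series and not by the
  convention \<open>\<infinity>\<close>.
\<close>

lemma weighted_cost_optimal:
  assumes "\<And>n. control_loss n = 0" "\<And>n. stop_loss (Suc n) = 0"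
  shows "weighted_cost lr_test \<le> ennreal (1 + R 1)"
proof -
  have total: "(\<Sum>n<k. stop_cost (Suc n)) + cont_cost k = ennreal (1 + R 1)" for k
    using cost_telescope[of k] assms by simp
  have le: "survival k \<le> ennreal ((1 + R 1) / real (Suc k))" for k
  proof -
    have "of_nat (Suc k) * survival k \<le> ennreal (1 + R 1)"
      using cont_cost_ge[of k] total[of k] by (metis add.commute le_iff_add order_trans)
    then have "ennreal (1 / real (Suc k)) * (of_nat (Suc k) * survival k)
        \<le> ennreal (1 / real (Suc k)) * ennreal (1 + R 1)"
      by (intro mult_left_mono) auto
    moreover have "ennreal (1 / real (Suc k)) * of_nat (Suc k) = 1"
      unfolding ennreal_of_nat_eq_real_of_nat by (subst ennreal_mult'[symmetric]) auto
    ultimately show ?thesis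
      by (simp add: mult.assoc[symmetric] ennreal_mult'[symmetric] del: of_nat_Suc)
  qed
  have "(\<lambda>k. ennreal ((1 + R 1) / real (Suc k))) \<longlonglongrightarrow> ennreal 0"
    by (intro tendsto_ennrealI LIMSEQ_Suc[OF lim_const_over_n])
  then have "(\<lambda>k. ennreal ((1 + R 1) / real (Suc k))) \<longlonglongrightarrow> 0"
    by (simp only: ennreal_0)
  then have surv: "survival \<longlonglongrightarrow> 0"
    by (rule tendsto_sandwich[OF _ _ tendsto_const, rotated 2])
       (intro always_eventually allI zero_le le)+
  have "weighted_cost lr_test = (\<Sum>n. stop_cost (Suc n))"
    unfolding weighted_cost_suminf[OF prob_stop_sums_1[OF surv]] Let_def by (simp only: stop_cost_eq)
  also have "\<dots> \<le> ennreal (1 + R 1)"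
    by (intro suminf_le_const summableI) (metis total le_iff_add)
  finally show ?thesis .
qed

end

section \<open>Optimality under error constraints\<close>

theorem theorem7p1:
  fixes X :: "'x measure" and \<mu> :: "'y measure"
    and f0 f1 :: "'y \<Rightarrow> 'x \<Rightarrow> real"
    and lam0 lam1 :: real
    and chi :: "nat \<Rightarrow> ('x, 'y, 'x) stagefun"
    and psi phi :: "nat \<Rightarrow> ('x, 'y, real) stagefun"
  assumes "sigma_finite_measure \<mu>"
    and "cond_density X \<mu> f0" and "cond_density X \<mu> f1"
    and "lam0 > 0" and "lam1 > 0"
    and "rho_R_well_defined X \<mu> f0 f1 lam0 lam1"
    and "trunc_well_defined X \<mu> f0 f1 lam0 lam1"
    and "strategy X \<mu> chi psi"
    and a: "\<forall>k\<ge>1. stop_cond X \<mu> f0 f1 lam0 lam1 chi psi k"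
    and b: "\<forall>k\<ge>1. control_cond X \<mu> f0 f1 lam0 lam1 chi psi k"
    and c: "init_cond X \<mu> f0 f1 lam0 lam1 chi"
    and phi_def: "phi = (\<lambda>n x y. of_bool (lam0 * dens f0 n x y \<le> lam1 * dens f1 n x y))"
  shows "\<forall>chi' psi' phi'.
    testing_procedure X \<mu> chi' psi' phi' \<and>
    err_alpha \<mu> f0 chi' psi' phi' \<le> err_alpha \<mu> f0 chi psi phi \<and>
    err_beta \<mu> f1 chi' psi' phi' \<le> err_beta \<mu> f1 chi psi phi \<longrightarrow>
      avg_sample_number \<mu> f0 chi' psi' \<ge> avg_sample_number \<mu> f0 chi psi \<and>
      (err_alpha \<mu> f0 chi' psi' phi' < err_alpha \<mu> f0 chi psi phi \<or>
       err_beta \<mu> f1 chi' psi' phi' < err_beta \<mu> f1 chi psi phi \<longrightarrow>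
         avg_sample_number \<mu> f0 chi' psi' > avg_sample_number \<mu> f0 chi psi) \<and>
      (err_alpha \<mu> f0 chi' psi' phi' = err_alpha \<mu> f0 chi psi phi \<and>
       err_beta \<mu> f1 chi' psi' phi' = err_beta \<mu> f1 chi psi phi \<and>
       avg_sample_number \<mu> f0 chi' psi' = avg_sample_number \<mu> f0 chi psi \<longrightarrow>
         (\<forall>k\<ge>1. stop_cond X \<mu> f0 f1 lam0 lam1 chi' psi' k) \<and>
         (\<forall>k\<ge>1. control_cond X \<mu> f0 f1 lam0 lam1 chi' psi' k) \<and>
         init_cond X \<mu> f0 f1 lam0 lam1 chi')"
proof (intro allI impI, elim conjE, goal_cases)
  case (1 chi' psi' phi')
  interpret opt: test_strategy X \<mu> f0 f1 lam0 lam1 chi psi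
    by (intro test_strategy.intro test_model.intro test_strategy_axioms.intro assms)
  interpret alt: test_strategy X \<mu> f0 f1 lam0 lam1 chi' psi'
    using 1(1) by unfold_locales (simp add: testing_procedure_def)
  have phi': "randomized_rule X \<mu> phi'"
    using 1(1) by (simp add: testing_procedure_def)
  have phi: "phi = opt.lr_test"
    by (simp add: phi_def opt.lr_test_def)
  have "opt.control_loss n = 0" for n
    using b c opt.control_cond_iff opt.init_cond_iff by (cases n) auto
  moreover have "opt.stop_loss (Suc n) = 0" for n
    using a opt.stop_cond_iff by auto
  ultimately have opt: "opt.weighted_cost phi \<le> ennreal (1 + opt.R 1)"
    unfolding phi by (intro opt.weighted_cost_optimal)
  then have fin: "opt.weighted_cost phi < \<infinity>"
    by (rule le_less_trans) simp
  show ?case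
  proof (cases "avg_sample_number \<mu> f0 chi' psi' < \<infinity>")
    case False
    \<comment> \<open>A competitor with infinite sample number loses strictly, since the sample number of the optimal procedure is finite.\<close>
    with fin show ?thesis
      by (auto simp: ennreal_add_less_top top.not_eq_extremum)
  next
    case True
    let ?d = "\<Sum>n. alt.control_loss n + alt.stop_loss (Suc n)"
    have "opt.weighted_cost phi + ?d \<le> alt.weighted_cost phi'"
      using add_right_mono[OF opt] alt.weighted_cost_ge[OF phi' True] by (rule order_trans)
    note comparison = constrained_from_weighted[OF assms(4,5) this fin True 1(2,3)]
    have "(\<forall>k\<ge>1. stop_cond X \<mu> f0 f1 lam0 lam1 chi' psi' k) \<and>
         (\<forall>k\<ge>1. control_cond X \<mu> f0 f1 lam0 lam1 chi' psi' k) \<and>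
         init_cond X \<mu> f0 f1 lam0 lam1 chi'" if "?d = 0"
    proof -
      have "alt.control_loss n + alt.stop_loss (Suc n) = 0" for n
        using that by (simp add: suminf_eq_zero_iff[OF summableI])
      then have loss: "alt.control_loss n = 0" "alt.stop_loss (Suc n) = 0" for n
        by simp_all
      have "stop_cond X \<mu> f0 f1 lam0 lam1 chi' psi' k" if "1 \<le> k" for k
        using loss(2)[of "k - 1"] that alt.stop_cond_iff[OF that] by simp
      then show ?thesis
        using loss(1) alt.control_cond_iff alt.init_cond_iff by simp
    qed
    with comparison show ?thesis by blast
  qed
qed

end
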